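(* Let $H_0,H_1,H_2$ be Hilbert spaces and let $A_0\colon \operatorname{dom}(A_0)\subseteq H_0\to H_1$ and $A_1\colon \operatorname{dom}(A_1)\subseteq H_1\to H_2$ be densely defined closed linear operators such that $(A_0,A_1)$ is a closed sequence. Let $(u_n)_n$ and $(v_n)_n$ be weakly convergent sequences in $H_1$. Assume that $(\widehat{A_0^*}u_n)_n$ is relatively compact in $\operatorname{dom}(A_0)^*$ and that $(\widehat{A_1}v_n)_n$ is relatively compact in $\operatorname{dom}(A_1^* )^*$. Further assume that $\ker(A_0^* )\cap\ker(A_1)$ is finite-dimensional. Then $$\lim_{n\to\infty}\langle u_n,v_n\rangle_{H_1}=\Big\langle \lim_{n\to\infty}u_n,\lim_{n\to\infty}v_n\Big\rangle_{H_1},$$ where the limits on the right-hand side are weak limits in $H_1$.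
   Context: For densely defined closed linear operators $A_0\colon \operatorname{dom}(A_0)\subseteq H_0\to H_1$ and $A_1\colon \operatorname{dom}(A_1)\subseteq H_1\to H_2$ between Hilbert spaces, the pair $(A_0,A_1)$ is called a sequence if $\operatorname{ran}(A_0)\subseteq\ker(A_1)$; it is a closed sequence if in addition $\operatorname{ran}(A_0)\subseteq H_1$ and $\operatorname{ran}(A_1)\subseteq H_2$ are closed. $A^*$ denotes the Hilbert space adjoint. Domains of closed operators carry the graph norm, and $\operatorname{dom}(A)^*$ is the dual space of $\operatorname{dom}(A)$ with its dual norm. Inner products are linear in the second argument. For $u\in H_1$, $\widehat{A_0^*}u$ is the functional $w\mapsto\langle u,A_0w\rangle_{H_1}$ on $\operatorname{dom}(A_0)$. For $v\in H_1$, $\widehat{A_1}v$ is the functional $w\mapsto\langle v,A_1^*w\rangle_{H_1}$ on $\operatorname{dom}(A_1^* )$. *)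

theory Defs
  imports "HOL-Analysis.Analysis"
begin

text \<open>
  The library has inner products over the reals only.  To treat real and complex Hilbert spaces
  at once, the scalars range over the following class.  Up to isomorphism, its only members are
  the reals (with trivial conjugation) and the complex numbers; see \<open>kcnj_cases\<close>.
\<close>

class real_or_complex = real_normed_field +
  fixes kcnj :: "'a \<Rightarrow> 'a"
  assumes kcnj_add: "kcnj (x + y) = kcnj x + kcnj y"
    and kcnj_mult: "kcnj (x * y) = kcnj x * kcnj y"
    and kcnj_kcnj: "kcnj (kcnj x) = x"
    and mult_kcnj_scaleR: "x * kcnj x = (norm x)\<^sup>2 *\<^sub>R 1"

instantiation real :: real_or_complex
begin
definition kcnj_real :: "real \<Rightarrow> real" where "kcnj_real x = x"
instance by standard (simp_all add: kcnj_real_def power2_eq_square)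
end

instantiation complex :: real_or_complex
begin
definition kcnj_complex :: "complex \<Rightarrow> complex" where "kcnj_complex = cnj"
instance
  by standard (simp_all add: kcnj_complex_def complex_mult_cnj cmod_power2 scaleR_conv_of_real)
end

lemma mult_kcnj: "x * kcnj x = of_real ((norm (x :: 'k::real_or_complex))\<^sup>2)"
  by (simp only: mult_kcnj_scaleR of_real_def)

lemma kcnj_fixed_imp_Reals:
  fixes y :: "'k::real_or_complex"
  assumes "kcnj y = y"
  shows "y \<in> \<real>"
proof -
  have "y * y = of_real (norm y) * of_real (norm y)"
    using mult_kcnj[of y] assms by (simp add: power2_eq_square)
  then have "y = of_real (norm y) \<or> y = - of_real (norm y)"
    by (simp only: square_eq_iff)
  then show ?thesis
    by (metis Reals_minus Reals_of_real)
qed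

lemma kcnj_uminus: "kcnj (- x) = - kcnj (x :: 'k::real_or_complex)"
  by (metis add_cancel_right_left add_eq_0_iff kcnj_add)

lemma kcnj_cases:
  "(\<forall>x::'k::real_or_complex. x \<in> \<real> \<and> kcnj x = x) \<or>
   (\<exists>i::'k. i * i = - 1 \<and> kcnj i = - i \<and> (\<forall>x. \<exists>a b. x = of_real a + of_real b * i))"
proof (cases "\<forall>x::'k. kcnj x = x")
  case True
  then show ?thesis
    using kcnj_fixed_imp_Reals by blast
next
  case False
  then obtain x0 :: 'k where x0: "kcnj x0 \<noteq> x0"
    by blast
  define j where "j = x0 - kcnj x0"
  have j0: "j \<noteq> 0" and cj: "kcnj j = - j"
    using x0 kcnj_add[of x0 "- kcnj x0"] by (simp_all add: j_def kcnj_uminus kcnj_kcnj)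
  have r: "kcnj (of_real t) = (of_real t :: 'k)" for t
  proof (cases "t \<ge> 0")
    case True
    then have "of_real t = (of_real (sqrt t) :: 'k) * kcnj (of_real (sqrt t))"
      using mult_kcnj[of "of_real (sqrt t) :: 'k"] by simp
    then show ?thesis
      by (metis kcnj_kcnj kcnj_mult mult.commute)
  next
    case False
    then have "of_real (- t) = (of_real (sqrt (- t)) :: 'k) * kcnj (of_real (sqrt (- t)))"
      using mult_kcnj[of "of_real (sqrt (- t)) :: 'k"] by simp
    then have "kcnj (of_real (- t)) = (of_real (- t) :: 'k)"
      by (metis kcnj_kcnj kcnj_mult mult.commute)
    then show ?thesis
      by (simp add: kcnj_uminus)
  qed
  define i where "i = of_real (1 / norm j) * j"
  have jj: "j * j = - of_real ((norm j)\<^sup>2)"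
    using mult_kcnj[of j] cj by (metis add.inverse_inverse mult_minus_right)
  have ii: "i * i = - 1"
  proof -
    have "i * i = of_real (1 / norm j) * of_real (1 / norm j) * (j * j)"
      by (simp add: i_def)
    also have "\<dots> = - of_real (1 / norm j * (1 / norm j) * (norm j)\<^sup>2)"
      by (simp only: jj of_real_mult mult_minus_right)
    also have "1 / norm j * (1 / norm j) * (norm j)\<^sup>2 = 1"
      using j0 by (simp add: power2_eq_square)
    finally show ?thesis by simp
  qed
  have ci: "kcnj i = - i"
    unfolding i_def kcnj_mult r cj by simp
  have "\<exists>a b. x = of_real a + of_real b * i" for x :: 'k
  proof -
    have "kcnj (x + kcnj x) = x + kcnj x"
      by (simp add: kcnj_add kcnj_kcnj)
    then obtain a where a: "x + kcnj x = of_real a"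
      using kcnj_fixed_imp_Reals by (metis Reals_cases)
    have "kcnj ((kcnj x - x) * i) = (kcnj x - x) * i"
      unfolding diff_conv_add_uminus kcnj_mult kcnj_add kcnj_uminus kcnj_kcnj ci
      by (simp add: algebra_simps)
    then obtain b where b: "(kcnj x - x) * i = of_real b"
      using kcnj_fixed_imp_Reals by (metis Reals_cases)
    have "of_real b * i = (kcnj x - x) * (i * i)"
      by (simp flip: b)
    then have "of_real b * i = x - kcnj x"
      by (simp add: ii)
    then have "of_real a + of_real b * i = 2 * x"
      by (simp flip: a)
    then have "x = of_real (a / 2) + of_real (b / 2) * i"
      by (simp add: field_simps)
    then show ?thesis by blast
  qed
  with ii ci show ?thesis by blast
qed

text \<open>
  A Hilbert space is a Banach space (norm, topology and completeness are those of the type class)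
  over the field of scalars \<open>'k\<close> whose norm comes from an inner product.  The inner product is
  conjugate-linear in the first and linear in the second argument; positive definiteness is
  contained in \<open>ip_norm\<close>.
\<close>

locale hilbert_space = vector_space smul
  for smul :: "'k::real_or_complex \<Rightarrow> 'a::banach \<Rightarrow> 'a" +
  fixes ip :: "'a \<Rightarrow> 'a \<Rightarrow> 'k"
  assumes scale_of_real: "smul (of_real r) x = r *\<^sub>R x"
    and ip_add_right: "ip x (y + z) = ip x y + ip x z"
    and ip_scale_right: "ip x (smul c y) = c * ip x y"
    and ip_commute: "ip y x = kcnj (ip x y)"
    and ip_norm: "ip x x = of_real ((norm x)\<^sup>2)"

lemma hilbert_space_real:
  "hilbert_space (scaleR :: real \<Rightarrow> 'a \<Rightarrow> 'a::{real_inner, banach}) inner"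
  by unfold_locales
    (simp_all add: algebra_simps kcnj_real_def inner_commute power2_norm_eq_inner)

lemma hilbert_space_complex:
  "hilbert_space ((*) :: complex \<Rightarrow> complex \<Rightarrow> complex) (\<lambda>x y. cnj x * y)"
proof unfold_locales
  show "cnj x * x = of_real ((norm x)\<^sup>2)" for x
    by (metis complex_norm_square mult.commute)
qed (simp_all add: algebra_simps kcnj_complex_def scaleR_conv_of_real)

text \<open>
  Dual spaces.  \<open>D\<close> is a linear subspace of the type \<open>'a\<close>, equipped with a norm \<open>N\<close> that need not
  be the norm of the type.  Functionals on \<open>D\<close> are \<^emph>\<open>extensional\<close>, i.e. have a fixed dummy value
  outside of \<open>D\<close>, so that equality of functions is equality on \<open>D\<close>.
\<close>

definition dual_space ::
  "('k::real_normed_field \<Rightarrow> 'a::ab_group_add \<Rightarrow> 'a) \<Rightarrow> 'a set \<Rightarrow> ('a \<Rightarrow> real) \<Rightarrow> ('a \<Rightarrow> 'k) set"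
  where "dual_space smul D N =
    {\<phi> \<in> extensional D.
      (\<forall>x\<in>D. \<forall>y\<in>D. \<phi> (x + y) = \<phi> x + \<phi> y) \<and>
      (\<forall>c. \<forall>x\<in>D. \<phi> (smul c x) = c * \<phi> x) \<and>
      (\<exists>C. \<forall>x\<in>D. norm (\<phi> x) \<le> C * N x)}"

definition dual_norm :: "'a set \<Rightarrow> ('a \<Rightarrow> real) \<Rightarrow> ('a \<Rightarrow> 'k::real_normed_field) \<Rightarrow> real"
  where "dual_norm D N \<phi> = (SUP x\<in>{x \<in> D. N x \<le> 1}. norm (\<phi> x))"

text \<open>The locale \<^locale>\<open>Metric_space\<close> wants distances to be nonnegative off the carrier, too.\<close>

definition dual_dist ::
  "('k::real_normed_field \<Rightarrow> 'a::ab_group_add \<Rightarrow> 'a) \<Rightarrow> 'a set \<Rightarrow> ('a \<Rightarrow> real)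
    \<Rightarrow> ('a \<Rightarrow> 'k) \<Rightarrow> ('a \<Rightarrow> 'k) \<Rightarrow> real"
  where "dual_dist smul D N \<phi> \<psi> =
    (if \<phi> \<in> dual_space smul D N \<and> \<psi> \<in> dual_space smul D N
     then dual_norm D N (\<lambda>x. \<phi> x - \<psi> x) else 0)"

definition dual_topology ::
  "('k::real_normed_field \<Rightarrow> 'a::ab_group_add \<Rightarrow> 'a) \<Rightarrow> 'a set \<Rightarrow> ('a \<Rightarrow> real) \<Rightarrow> ('a \<Rightarrow> 'k) topology"
  where "dual_topology smul D N =
    Metric_space.mtopology (dual_space smul D N) (dual_dist smul D N)"

lemma Metric_space_dual_space:
  fixes smul :: "'k::real_normed_field \<Rightarrow> 'a::ab_group_add \<Rightarrow> 'a"
  assumes D: "module.subspace smul D" and "vector_space smul"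
    and N0: "\<And>x. x \<in> D \<Longrightarrow> 0 \<le> N x"
    and Ns: "\<And>c x. x \<in> D \<Longrightarrow> N (smul c x) = norm c * N x"
  shows "Metric_space (dual_space smul D N) (dual_dist smul D N)"
proof -
  interpret vector_space smul by fact
  let ?B = "{x \<in> D. N x \<le> 1}"
  have zD: "0 \<in> D" using D by (rule subspace_0)
  have "N 0 = 0" using Ns[OF zD, of 0] by simp
  with zD have z: "0 \<in> ?B" by simp
  have lip: "\<exists>C\<ge>0. \<forall>x\<in>D. norm (\<phi> x - \<psi> x) \<le> C * N x"
    if pq: "\<phi> \<in> dual_space smul D N" "\<psi> \<in> dual_space smul D N" for \<phi> \<psi>
  proof -
    obtain C E where C: "\<forall>x\<in>D. norm (\<phi> x) \<le> C * N x" and E: "\<forall>x\<in>D. norm (\<psi> x) \<le> E * N x"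
      using pq unfolding dual_space_def by blast
    have "norm (\<phi> x - \<psi> x) \<le> (\<bar>C\<bar> + \<bar>E\<bar>) * N x" if x: "x \<in> D" for x
    proof -
      have "C * N x \<le> \<bar>C\<bar> * N x" "E * N x \<le> \<bar>E\<bar> * N x"
        using N0[OF x] by (simp_all add: mult_right_mono)
      moreover have "norm (\<phi> x) \<le> C * N x" "norm (\<psi> x) \<le> E * N x" using C E x by auto
      ultimately show ?thesis
        using norm_triangle_ineq4[of "\<phi> x" "\<psi> x"] by (simp add: distrib_right)
    qed
    then show ?thesis by (intro exI[of _ "\<bar>C\<bar> + \<bar>E\<bar>"]) auto
  qed
  have bdd: "bdd_above ((\<lambda>x. norm (\<phi> x - \<psi> x)) ` ?B)"
    if pq: "\<phi> \<in> dual_space smul D N" "\<psi> \<in> dual_space smul D N" for \<phi> \<psi>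
  proof -
    obtain C where "C \<ge> 0" and C: "\<forall>x\<in>D. norm (\<phi> x - \<psi> x) \<le> C * N x"
      using lip[OF pq] by blast
    then have "norm (\<phi> x - \<psi> x) \<le> C" if "x \<in> ?B" for x
      using that mult_left_le[of "N x" C] by force
    then show ?thesis by (intro bdd_aboveI2[where M = C])
  qed
  have up: "norm (\<phi> x - \<psi> x) \<le> dual_dist smul D N \<phi> \<psi>"
    if "\<phi> \<in> dual_space smul D N" "\<psi> \<in> dual_space smul D N" "x \<in> ?B" for \<phi> \<psi> x
    using that(1,2) cSUP_upper[OF that(3) bdd[OF that(1,2)]] by (simp add: dual_dist_def dual_norm_def)
  have refl: "dual_dist smul D N \<phi> \<phi> = 0" for \<phi> :: "'a \<Rightarrow> 'k"
  proof -
    have "(\<lambda>x. norm (\<phi> x - \<phi> x)) ` ?B = {0}" using z by auto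
    then show ?thesis unfolding dual_dist_def dual_norm_def by simp
  qed
  have sc: "\<phi> (smul c x) = c * \<phi> x" if "\<phi> \<in> dual_space smul D N" "x \<in> D" for \<phi> c x
    using that unfolding dual_space_def by blast
  have eq: "\<phi> = \<psi>"
    if pq: "\<phi> \<in> dual_space smul D N" "\<psi> \<in> dual_space smul D N"
      and d0: "dual_dist smul D N \<phi> \<psi> = 0" for \<phi> \<psi>
  proof (rule extensionalityI[of _ D])
    show "\<phi> \<in> extensional D" "\<psi> \<in> extensional D" using pq unfolding dual_space_def by auto
    fix x assume x: "x \<in> D"
    show "\<phi> x = \<psi> x"
    proof (cases "N x = 0")
      case True
      then show ?thesis using lip[OF pq] x by force
    next
      case False
      then have pos: "N x > 0" using N0[OF x] by simp
      define c :: 'k where "c = of_real (1 / N x)"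
      have "N (smul c x) = 1" using pos unfolding Ns[OF x] c_def by (simp add: norm_divide)
      then have "smul c x \<in> ?B" using subspace_scale[OF D x] by simp
      from up[OF pq this] d0 have "\<phi> (smul c x) = \<psi> (smul c x)" by simp
      then have "c * \<phi> x = c * \<psi> x" using sc pq x by simp
      moreover have "c \<noteq> 0" using pos by (simp add: c_def)
      ultimately show ?thesis by simp
    qed
  qed
  show ?thesis
  proof
    fix \<phi> \<psi> \<xi> :: "'a \<Rightarrow> 'k"
    show "0 \<le> dual_dist smul D N \<phi> \<psi>"
    proof (cases "\<phi> \<in> dual_space smul D N \<and> \<psi> \<in> dual_space smul D N")
      case True
      then have "norm (\<phi> 0 - \<psi> 0) \<le> dual_dist smul D N \<phi> \<psi>" using up z by blast
      then show ?thesis using norm_ge_zero order_trans by blast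
    qed (auto simp: dual_dist_def)
    show "dual_dist smul D N \<phi> \<psi> = dual_dist smul D N \<psi> \<phi>"
      unfolding dual_dist_def dual_norm_def by (simp add: norm_minus_commute conj_commute)
    assume p: "\<phi> \<in> dual_space smul D N" and q: "\<psi> \<in> dual_space smul D N"
    show "dual_dist smul D N \<phi> \<psi> = 0 \<longleftrightarrow> \<phi> = \<psi>"
      using eq[OF p q] refl by blast
    assume r: "\<xi> \<in> dual_space smul D N"
    have "norm (\<phi> x - \<xi> x) \<le> dual_dist smul D N \<phi> \<psi> + dual_dist smul D N \<psi> \<xi>" if "x \<in> ?B" for x
      using up[OF p q that] up[OF q r that] norm_triangle_ineq[of "\<phi> x - \<psi> x" "\<psi> x - \<xi> x"] by simp
    then have "(SUP x\<in>?B. norm (\<phi> x - \<xi> x)) \<le> dual_dist smul D N \<phi> \<psi> + dual_dist smul D N \<psi> \<xi>"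
      using z by (intro cSUP_least) blast+
    then show "dual_dist smul D N \<phi> \<xi> \<le> dual_dist smul D N \<phi> \<psi> + dual_dist smul D N \<psi> \<xi>"
      using p r by (simp add: dual_dist_def dual_norm_def)
  qed
qed

definition relatively_compactin :: "'a topology \<Rightarrow> 'a set \<Rightarrow> bool"
  where "relatively_compactin X S \<longleftrightarrow> S \<subseteq> topspace X \<and> compactin X (X closure_of S)"

definition weakly_tendsto ::
  "('k::real_normed_field \<Rightarrow> 'a::real_normed_vector \<Rightarrow> 'a) \<Rightarrow> (nat \<Rightarrow> 'a) \<Rightarrow> 'a \<Rightarrow> bool"
  where "weakly_tendsto smul u l \<longleftrightarrow>
    (\<forall>\<phi>\<in>dual_space smul UNIV norm. (\<lambda>n. \<phi> (u n)) \<longlonglongrightarrow> \<phi> l)"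

definition finite_dim_subspace ::
  "('k::field \<Rightarrow> 'a::ab_group_add \<Rightarrow> 'a) \<Rightarrow> 'a set \<Rightarrow> bool"
  where "finite_dim_subspace smul S \<longleftrightarrow> (\<exists>B. finite B \<and> module.span smul B = S)"

text \<open>
  A partially defined operator; the values of \<open>app\<close> outside of \<open>domain\<close> are irrelevant.
\<close>

record ('a, 'b) partial_op =
  domain :: "'a set"
  app :: "'a \<Rightarrow> 'b"

definition op_ran :: "('a, 'b) partial_op \<Rightarrow> 'b set"
  where "op_ran A = app A ` domain A"

definition op_ker :: "('a, 'b::zero) partial_op \<Rightarrow> 'a set"
  where "op_ker A = {x \<in> domain A. app A x = 0}"

definition op_graph :: "('a, 'b) partial_op \<Rightarrow> ('a \<times> 'b) set"
  where "op_graph A = {(x, app A x) | x. x \<in> domain A}"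

definition graph_norm :: "('a::real_normed_vector, 'b::real_normed_vector) partial_op \<Rightarrow> 'a \<Rightarrow> real"
  where "graph_norm A x = sqrt ((norm x)\<^sup>2 + (norm (app A x))\<^sup>2)"

definition densely_defined_closed_linear ::
  "('k::field \<Rightarrow> 'a::real_normed_vector \<Rightarrow> 'a) \<Rightarrow> ('k \<Rightarrow> 'b::real_normed_vector \<Rightarrow> 'b)
    \<Rightarrow> ('a, 'b) partial_op \<Rightarrow> bool"
  where "densely_defined_closed_linear smul smul' A \<longleftrightarrow>
    module.subspace smul (domain A) \<and>
    (\<forall>x\<in>domain A. \<forall>y\<in>domain A. app A (x + y) = app A x + app A y) \<and>
    (\<forall>c. \<forall>x\<in>domain A. app A (smul c x) = smul' c (app A x)) \<and>
    closure (domain A) = UNIV \<and>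
    closed (op_graph A)"

text \<open>
  The Hilbert space adjoint; \<open>ip\<close> and \<open>ip'\<close> are the inner products of the domain and codomain
  space.  The description operator is well-defined if \<open>A\<close> is densely defined.
\<close>

definition adjoint_op ::
  "('a \<Rightarrow> 'a \<Rightarrow> 'k) \<Rightarrow> ('b \<Rightarrow> 'b \<Rightarrow> 'k) \<Rightarrow> ('a, 'b) partial_op \<Rightarrow> ('b, 'a) partial_op"
  where "adjoint_op ip ip' A =
    \<lparr> domain = {y. \<exists>z. \<forall>x\<in>domain A. ip' y (app A x) = ip z x},
      app = (\<lambda>y. THE z. \<forall>x\<in>domain A. ip' y (app A x) = ip z x) \<rparr>"

definition closed_sequence ::
  "('a, 'b::{topological_space, zero}) partial_op \<Rightarrow> ('b, 'c::{topological_space, zero}) partial_op \<Rightarrow> bool"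
  where "closed_sequence A B \<longleftrightarrow>
    op_ran A \<subseteq> op_ker B \<and> closed (op_ran A) \<and> closed (op_ran B)"

text \<open>
  \<open>weak_functional ip B u\<close> is the functional \<open>w \<mapsto> \<langle>u, B w\<rangle>\<close> on the domain of \<open>B\<close>, where \<open>ip\<close> is
  the inner product of the codomain of \<open>B\<close>.  It is the weak extension of the adjoint of \<open>B\<close>,
  applied to \<open>u\<close>: taking \<open>B = A\<^sub>0\<close> gives the hatted \<open>A\<^sub>0\<^sup>*\<close>, and taking \<open>B = A\<^sub>1\<^sup>*\<close> gives the hatted
  \<open>A\<^sub>1\<close>.
\<close>

definition weak_functional ::
  "('b \<Rightarrow> 'b \<Rightarrow> 'k) \<Rightarrow> ('a, 'b) partial_op \<Rightarrow> 'b \<Rightarrow> 'a \<Rightarrow> 'k"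
  where "weak_functional ip B u = restrict (\<lambda>w. ip u (app B w)) (domain B)"

end

theory Submission
  imports Defs
begin

text \<open>
  Let \<open>R = ran A\<^sub>0\<close> and \<open>K = ker A\<^sub>1\<close>, so that \<open>R \<subseteq> K\<close> are closed subspaces, and let \<open>P\<close> and \<open>N\<close> be
  the orthogonal projections onto them.  Then
  \<open>\<langle>u, v\<rangle> = \<langle>P u, v\<rangle> + \<langle>(N - P) u, v\<rangle> + \<langle>u, (1 - N) v\<rangle>\<close>,
  and it suffices that one factor of each term converges strongly, because weakly convergent
  sequences are bounded.  By the open mapping theorem, each \<open>y \<in> R\<close> is \<open>A\<^sub>0 x\<close> with
  \<open>\<parallel>x\<parallel> \<le> C \<parallel>y\<parallel>\<close>; hence \<open>\<parallel>P u\<parallel>\<close> is controlled by the dual norm of the functional of \<open>u\<close>, and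
  relative compactness together with pointwise convergence gives convergence in the dual norm.
  The same argument applies to \<open>(1 - N) v\<close>, since \<open>A\<^sub>1\<^sup>*\<close> maps onto the orthogonal complement
  of \<open>K\<close>, again with bounded preimages.  Finally, \<open>N - P\<close> is the projection onto the
  finite-dimensional space \<open>ker A\<^sub>0\<^sup>* \<inter> ker A\<^sub>1\<close>.
\<close>

subsection \<open>Consequences of the Baire category theorem\<close>

text \<open>A closed \<open>Y\<close> in a complete space is completely metrizable, so the Baire
  theorem applies to its subspace topology. Working relative to \<open>Y\<close> makes the result
  usable for ranges that are proper subspaces.\<close>

lemma closed_cover_has_interior:
  fixes Y :: "'a::complete_space set" and S :: "nat \<Rightarrow> 'a set"
  assumes "closed Y" and "Y \<noteq> {}" and S: "\<And>n. closed (S n)" and cover: "Y \<subseteq> (\<Union>n. S n)"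
  obtains n y e where "y \<in> Y" "0 < e" "ball y e \<inter> Y \<subseteq> S n"
proof -
  let ?X = "top_of_set Y"
  have cm: "completely_metrizable_space ?X"
    using assms(1) by (intro completely_metrizable_space_closedin completely_metrizable_space_euclidean) simp
  have un: "\<Union> (range (\<lambda>n. Y \<inter> S n)) = Y" using cover by auto
  have cl: "closedin ?X (Y \<inter> S n)" for n
    using S[of n] by (simp add: closedin_closed_Int)
  have "\<exists>n. ?X interior_of (Y \<inter> S n) \<noteq> {}"
  proof (rule ccontr)
    assume "\<not> ?thesis"
    then have "?X interior_of \<Union> (range (\<lambda>n. Y \<inter> S n)) = {}"
      using cl by (intro Baire_category_alt disjI1 cm) auto
    then show False
      using assms(2) interior_of_topspace[of ?X] unfolding un by simp
  qed
  then obtain n y where y: "y \<in> ?X interior_of (Y \<inter> S n)" by blast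
  then obtain T where T: "openin ?X T" "y \<in> T" "T \<subseteq> Y \<inter> S n"
    unfolding interior_of_def by blast
  then obtain e where "0 < e" "ball y e \<inter> Y \<subseteq> T"
    unfolding openin_contains_ball by blast
  with T show thesis by (intro that[of y e n]) auto
qed

lemma uniform_boundedness:
  fixes f :: "nat \<Rightarrow> 'a::banach \<Rightarrow> 'b::real_normed_vector"
  assumes lin: "\<And>n. bounded_linear (f n)" and bdd: "\<And>x. bounded (range (\<lambda>n. f n x))"
  obtains C where "\<And>n x. norm (f n x) \<le> C * norm x"
proof -
  define S where "S m = {x. \<forall>n. norm (f n x) \<le> real m}" for m
  have "closed (S m)" for m
    unfolding S_def
    by (intro closed_Collect_all closed_Collect_le continuous_intros
        bounded_linear.continuous_on[OF lin])
  moreover have "UNIV \<subseteq> (\<Union>m. S m)"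
  proof
    fix x
    obtain B where "\<And>n. norm (f n x) \<le> B"
      using bdd[of x] unfolding bounded_iff by blast
    moreover obtain m where "B \<le> real m" using real_arch_simple by blast
    ultimately show "x \<in> (\<Union>m. S m)" unfolding S_def by (auto intro: order_trans)
  qed
  ultimately obtain m y e where "y \<in> UNIV" and e: "0 < e" "ball y e \<inter> UNIV \<subseteq> S m"
    by (rule closed_cover_has_interior[OF closed_UNIV UNIV_not_empty])
  \<comment> \<open>Such an \<open>x\<close> is the difference of \<open>y + x\<close> and
    \<open>y\<close>, both of which lie in \<open>S m\<close>.\<close>
  have *: "norm (f n x) \<le> 2 * real m" if "norm x < e" for n x
  proof -
    interpret bounded_linear "f n" by (rule lin)
    have "y + x \<in> S m" "y \<in> S m" using e that by (auto simp: dist_norm)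
    then have "norm (f n (y + x)) \<le> m" "norm (f n y) \<le> m" by (auto simp: S_def)
    then show ?thesis
      using norm_triangle_ineq4[of "f n (y + x)" "f n y"] by (simp add: add)
  qed
  have "norm (f n x) \<le> (4 * real m / e) * norm x" for n x
  proof (cases "x = 0")
    case True
    interpret bounded_linear "f n" by (rule lin)
    show ?thesis using True by (simp add: zero)
  next
    case False
    interpret bounded_linear "f n" by (rule lin)
    \<comment> \<open>Rescaling \<open>x\<close> to norm \<open>e / 2\<close> turns the bound
      \<open>2 * real m\<close> into the constant \<open>4 * real m / e\<close>.\<close>
    let ?t = "e / (2 * norm x)"
    have "norm (?t *\<^sub>R x) < e" using False e(1) by simp
    from *[OF this, of n] have "?t * norm (f n x) \<le> 2 * real m"
      using e(1) by (simp add: scaleR)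
    then show ?thesis using False e(1) by (simp add: field_simps)
  qed
  then show thesis by (rule that)
qed

text \<open>Baire only controls the closure of some \<open>B m\<close>, hence approximate preimages;
  the error \<open>norm y / 2\<close> is what \<open>open_mapping\<close> iterates. A linear
  relation \<open>G\<close> in place of a map covers partially defined operators.\<close>

lemma open_mapping_approx:
  fixes G :: "('a::real_normed_vector \<times> 'b::banach) set"
  assumes G: "subspace G" and ran: "closed (snd ` G)"
  obtains C where "0 \<le> C"
    "\<And>y. y \<in> snd ` G \<Longrightarrow> \<exists>g\<in>G. norm (fst g) \<le> C * norm y \<and> norm (y - snd g) \<le> norm y / 2"
proof -
  define B where "B m = snd ` {g \<in> G. norm (fst g) \<le> real m}" for m
  have "snd ` G \<noteq> {}" using subspace_0[OF G] by auto
  moreover have "snd ` G \<subseteq> (\<Union>m. closure (B m))"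
  proof
    fix y assume "y \<in> snd ` G"
    then obtain g where g: "g \<in> G" "y = snd g" by blast
    obtain m where "norm (fst g) \<le> real m" using real_arch_simple by blast
    then have "y \<in> B m" using g by (auto simp: B_def)
    then show "y \<in> (\<Union>m. closure (B m))" using closure_subset by blast
  qed
  ultimately obtain m y0 e where y0: "y0 \<in> snd ` G" and e: "0 < e"
    and sub: "ball y0 e \<inter> snd ` G \<subseteq> closure (B m)"
    by (rule closed_cover_has_interior[OF ran _ closed_closure])
  have Y: "subspace (snd ` G)"
    using G by (intro linear_subspace_image bounded_linear.linear bounded_linear_snd)
  txt \<open>\<open>closure (B m)\<close> contains a ball around \<open>y0\<close>, hence differences of its points fill one around \<open>0\<close>.\<close>
  have near: "\<exists>g\<in>G. norm (fst g) \<le> 2 * real m \<and> norm (y - snd g) \<le> d"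
    if y: "y \<in> snd ` G" "norm y < e" and d: "0 < d" for y d
  proof -
    have "y0 + y \<in> closure (B m)" "y0 \<in> closure (B m)"
      by (intro subsetD[OF sub]; use y e y0 subspace_add[OF Y y0 y(1)] in \<open>simp add: dist_norm\<close>)+
    then obtain b b' where b: "b \<in> B m" "dist b (y0 + y) < d / 2" and b': "b' \<in> B m" "dist b' y0 < d / 2"
      using d unfolding closure_approachable by (meson half_gt_zero)
    then obtain g g' where g: "g \<in> G" "norm (fst g) \<le> m" "b = snd g"
      and g': "g' \<in> G" "norm (fst g') \<le> m" "b' = snd g'"
      unfolding B_def by blast
    have "norm (fst (g - g')) \<le> 2 * real m"
      using norm_triangle_ineq4[of "fst g" "fst g'"] g g' by simp
    moreover have "norm (y - snd (g - g')) \<le> d"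
    proof -
      have "norm (y - snd (g - g')) = norm ((b' - y0) - (b - (y0 + y)))"
        using g g' by (simp add: algebra_simps)
      also have "\<dots> \<le> norm (b' - y0) + norm (b - (y0 + y))" by (rule norm_triangle_ineq4)
      also have "\<dots> \<le> d" using b(2) b'(2) by (simp add: dist_norm)
      finally show ?thesis .
    qed
    ultimately show ?thesis using subspace_diff[OF G g(1) g'(1)] by blast
  qed
  show thesis
  proof
    show "0 \<le> 4 * real m / e" using e by simp
    fix y assume y: "y \<in> snd ` G"
    show "\<exists>g\<in>G. norm (fst g) \<le> 4 * real m / e * norm y \<and> norm (y - snd g) \<le> norm y / 2"
    proof (cases "y = 0")
      case True
      then show ?thesis using subspace_0[OF G] by force
    next
      case False
      \<comment> \<open>\<open>?t *\<^sub>R y\<close> has norm \<open>e / 2\<close>, so the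
        tolerance \<open>e / 4\<close> is half of it. Dividing by \<open>?t\<close> gives the error
        \<open>norm y / 2\<close> and turns \<open>2 * real m\<close> into
        \<open>4 * real m / e * norm y\<close>.\<close>
      let ?t = "e / (2 * norm y)"
      have t: "0 < ?t" using False e by simp
      have "?t *\<^sub>R y \<in> snd ` G" "norm (?t *\<^sub>R y) < e"
        using subspace_scale[OF Y y] False e by auto
      from near[OF this, of "e / 4"] e obtain g where g: "g \<in> G" "norm (fst g) \<le> 2 * real m"
        "norm (?t *\<^sub>R y - snd g) \<le> e / 4" by auto
      let ?g = "(1 / ?t) *\<^sub>R g"
      have "norm (fst ?g) \<le> 4 * real m / e * norm y"
        using g(2) False e by (simp add: field_simps)
      moreover have "norm (y - snd ?g) = (1 / ?t) * norm (?t *\<^sub>R y - snd g)"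
      proof -
        have "y - snd ?g = (1 / ?t) *\<^sub>R (?t *\<^sub>R y - snd g)"
          using False e by (simp add: scaleR_diff_right)
        then show ?thesis using t by (simp only: norm_scaleR abs_of_pos zero_less_divide_1_iff)
      qed
      moreover have "(1 / ?t) * norm (?t *\<^sub>R y - snd g) \<le> (1 / ?t) * (e / 4)"
        using g(3) e by (intro mult_left_mono) auto
      moreover have "(1 / ?t) * (e / 4) = norm y / 2" using e False by (simp add: field_simps)
      ultimately have "norm (fst ?g) \<le> 4 * real m / e * norm y \<and> norm (y - snd ?g) \<le> norm y / 2"
        by linarith
      then show ?thesis using subspace_scale[OF G g(1)] by blast
    qed
  qed
qed

text \<open>Each approximation halves the remainder, so the approximate preimages form an absolutely
  convergent series. Completeness supplies its sum, and closedness of \<open>G\<close> makes the sum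
  an exact preimage.\<close>

lemma open_mapping:
  fixes G :: "('a::banach \<times> 'b::banach) set"
  assumes G: "subspace G" "closed G" and ran: "closed (snd ` G)"
  obtains C where "\<And>y. y \<in> snd ` G \<Longrightarrow> \<exists>x. (x, y) \<in> G \<and> norm x \<le> C * norm y"
proof -
  obtain C where C: "0 \<le> C" and step:
    "\<And>y. y \<in> snd ` G \<Longrightarrow> \<exists>g\<in>G. norm (fst g) \<le> C * norm y \<and> norm (y - snd g) \<le> norm y / 2"
    using open_mapping_approx[OF G(1) ran] by blast
  then obtain h where h: "\<And>y. y \<in> snd ` G \<Longrightarrow>
    h y \<in> G \<and> norm (fst (h y)) \<le> C * norm y \<and> norm (y - snd (h y)) \<le> norm y / 2"
    by metis
  have Y: "subspace (snd ` G)"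
    using G by (intro linear_subspace_image bounded_linear.linear bounded_linear_snd)
  have "\<exists>x. (x, y) \<in> G \<and> norm x \<le> (2 * C) * norm y" if y: "y \<in> snd ` G" for y
  proof -
    txt \<open>The remainders of \<open>y\<close> after repeatedly subtracting approximations from \<open>snd ` G\<close>.\<close>
    define r where "r k = ((\<lambda>z. z - snd (h z)) ^^ k) y" for k
    have r0: "r 0 = y" and rS: "r (Suc k) = r k - snd (h (r k))" for k
      by (simp_all add: r_def)
    have rY: "r k \<in> snd ` G" for k
    proof (induction k)
      case (Suc k)
      then show ?case unfolding rS using h by (intro subspace_diff[OF Y]) blast+
    qed (simp only: r0 y)
    have rn: "norm (r k) \<le> norm y * (1/2) ^ k" for k
    proof (induction k)
      case (Suc k)
      then show ?case using h[OF rY[of k]] by (simp add: rS)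
    qed (simp add: r0)
    have xn: "norm (fst (h (r k))) \<le> C * norm y * (1/2) ^ k" for k
    proof -
      have "norm (fst (h (r k))) \<le> C * norm (r k)" using h[OF rY] by blast
      also have "\<dots> \<le> C * (norm y * (1/2) ^ k)" using rn C by (rule mult_left_mono)
      finally show ?thesis by (simp add: mult.assoc)
    qed
    \<comment> \<open>The sum of this geometric series is the source of the factor 2 in
      \<open>2 * C\<close>.\<close>
    have geo: "(\<lambda>k. C * norm y * (1/2) ^ k) sums (C * norm y * (1 / (1 - 1/2)))"
      by (intro sums_mult geometric_sums) simp
    define x where "x = (\<Sum>k. fst (h (r k)))"
    have sx: "summable (\<lambda>k. norm (fst (h (r k))))"
      using xn by (intro summable_comparison_test'[OF sums_summable[OF geo], of 0]) auto
    have xs: "(\<lambda>k. fst (h (r k))) sums x"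
      unfolding x_def by (rule summable_sums[OF summable_norm_cancel[OF sx]])
    have "norm x \<le> (\<Sum>k. norm (fst (h (r k))))" unfolding x_def using sx by (rule summable_norm)
    also have "\<dots> \<le> C * norm y * (1 / (1 - 1/2))"
      using xn by (rule sums_le[OF _ summable_sums[OF sx] geo])
    also have "\<dots> = (2 * C) * norm y" by simp
    finally have nx: "norm x \<le> (2 * C) * norm y" .
    have "r \<longlonglongrightarrow> 0"
    proof (rule Lim_null_comparison)
      show "\<forall>\<^sub>F k in sequentially. norm (r k) \<le> norm y * (1/2) ^ k" using rn by simp
      show "(\<lambda>k. norm y * (1/2) ^ k) \<longlonglongrightarrow> 0"
        by (intro tendsto_mult_right_zero LIMSEQ_power_zero) simp
    qed
    \<comment> \<open>Consecutive remainders differ by \<open>snd (h (r k))\<close>, so these terms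
      telescope to \<open>r 0 = y\<close>.\<close>
    from telescope_sums'[OF this] have ys: "(\<lambda>k. snd (h (r k))) sums y"
      by (simp add: rS r0)
    have "(\<lambda>n. (\<Sum>k<n. h (r k))) \<longlonglongrightarrow> (x, y)"
      using tendsto_Pair[OF xs[unfolded sums_def] ys[unfolded sums_def]]
      by (simp add: fst_sum[symmetric] snd_sum[symmetric])
    moreover have "(\<Sum>k<n. h (r k)) \<in> G" for n
      using h[OF rY] by (intro subspace_sum[OF G(1)]) auto
    ultimately have "(x, y) \<in> G"
      using closed_sequentially[OF G(2), of "\<lambda>n. \<Sum>k<n. h (r k)" "(x, y)"] by blast
    with nx show ?thesis by blast
  qed
  then show thesis by (rule that)
qed

subsection \<open>Hilbert spaces\<close>

lemma kcnj_zero [simp]: "kcnj (0::'k::real_or_complex) = 0"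
  using kcnj_add[of "0::'k" 0] by simp

lemma norm_kcnj [simp]: "norm (kcnj x) = norm (x :: 'k::real_or_complex)"
proof -
  have "(of_real ((norm (kcnj x))\<^sup>2) :: 'k) = of_real ((norm x)\<^sup>2)"
    by (metis kcnj_kcnj mult.commute mult_kcnj)
  then show ?thesis by (simp only: of_real_eq_iff power2_eq_iff_nonneg norm_ge_zero)
qed

lemma kcnj_diff: "kcnj (x - y) = kcnj x - kcnj (y :: 'k::real_or_complex)"
  by (simp only: diff_conv_add_uminus kcnj_add kcnj_uminus)

lemma tendsto_kcnj:
  fixes l :: "'k::real_or_complex"
  assumes "(f \<longlongrightarrow> l) F"
  shows "((\<lambda>x. kcnj (f x)) \<longlongrightarrow> kcnj l) F"
proof -
  have "((\<lambda>x. norm (kcnj (f x) - kcnj l)) \<longlongrightarrow> 0) F"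
    using assms by (simp flip: kcnj_diff add: tendsto_norm_zero_iff LIM_zero_iff)
  then show ?thesis by (simp add: tendsto_norm_zero_iff LIM_zero_iff)
qed

section \<open>Geometry of the inner product\<close>

context hilbert_space
begin

lemma ip_add_left: "ip (x + y) z = ip x z + ip y z"
  by (metis ip_add_right ip_commute kcnj_add)

lemma ip_scale_left: "ip (smul c x) y = kcnj c * ip x y"
  by (metis ip_commute ip_scale_right kcnj_mult)

lemma ip_zero_right [simp]: "ip x 0 = 0"
  using ip_add_right[of x 0 0] by simp

lemma ip_zero_left [simp]: "ip 0 x = 0"
  using ip_add_left[of 0 0 x] by simp

lemma ip_diff_right: "ip x (y - z) = ip x y - ip x z"
  using ip_add_right[of x "y - z" z] by simp

lemma ip_diff_left: "ip (x - y) z = ip x z - ip y z"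
  using ip_add_left[of "x - y" y z] by simp

lemma ip_sum_right: "ip x (sum f A) = (\<Sum>i\<in>A. ip x (f i))"
  by (induction A rule: infinite_finite_induct) (simp_all add: ip_add_right)

lemma ip_zero_commute: "ip x y = 0 \<Longrightarrow> ip y x = 0"
  by (metis ip_commute kcnj_zero)

lemma ip_self_eq_zero [simp]: "ip x x = 0 \<longleftrightarrow> x = 0"
  by (simp add: ip_norm)

text \<open>The type class gives homogeneity for real factors only; for scalars in \<open>'k\<close>
  it comes from \<open>ip_norm\<close> and \<open>mult_kcnj\<close>.\<close>

lemma norm_scale: "norm (smul c x) = norm c * norm x"
proof -
  have "(of_real ((norm (smul c x))\<^sup>2) :: 'k) = (c * kcnj c) * ip x x"
    by (simp only: ip_norm[symmetric] ip_scale_left ip_scale_right mult_ac)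
  also have "\<dots> = of_real ((norm c * norm x)\<^sup>2)"
    by (simp only: mult_kcnj ip_norm power_mult_distrib of_real_mult)
  finally have "(of_real ((norm (smul c x))\<^sup>2) :: 'k) = of_real ((norm c * norm x)\<^sup>2)" .
  then show ?thesis by (simp only: of_real_eq_iff power2_eq_iff_nonneg norm_ge_zero mult_nonneg_nonneg)
qed

lemma pythagoras:
  assumes "ip x y = 0"
  shows "(norm (x + y))\<^sup>2 = (norm x)\<^sup>2 + (norm y)\<^sup>2"
proof -
  have "(of_real ((norm (x + y))\<^sup>2) :: 'k) = of_real ((norm x)\<^sup>2 + (norm y)\<^sup>2)"
    using assms ip_zero_commute[OF assms]
    by (simp only: of_real_add ip_norm[symmetric] ip_add_left ip_add_right) simp
  then show ?thesis by (simp only: of_real_eq_iff)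
qed

lemma parallelogram:
  fixes x y :: 'a
  shows "(norm (x + y))\<^sup>2 + (norm (x - y))\<^sup>2 = 2 * (norm x)\<^sup>2 + 2 * (norm y)\<^sup>2"
proof -
  have "ip (x + y) (x + y) + ip (x - y) (x - y) = ip x x + ip x x + (ip y y + ip y y)"
    by (simp add: ip_add_left ip_add_right ip_diff_left ip_diff_right)
  then have "(norm (x + y))\<^sup>2 + (norm (x - y))\<^sup>2
    = (norm x)\<^sup>2 + (norm x)\<^sup>2 + ((norm y)\<^sup>2 + (norm y)\<^sup>2)"
    by (simp only: ip_norm of_real_eq_iff flip: of_real_add)
  then show ?thesis by simp
qed

text \<open>\<open>smul c y\<close> is the component of \<open>x\<close> along \<open>y\<close>; for
  \<open>y = 0\<close>, division by zero gives \<open>c = 0\<close> and both claims are trivial. The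
  second claim yields Cauchy-Schwarz and, in \<open>ex_projection\<close>, orthogonality from
  minimality.\<close>

lemma orthogonal_component:
  fixes x y
  defines "c \<equiv> ip y x / ip y y"
  shows "ip y (x - smul c y) = 0" "(norm x)\<^sup>2 = (norm (x - smul c y))\<^sup>2 + (norm (smul c y))\<^sup>2"
proof -
  show o: "ip y (x - smul c y) = 0"
    by (cases "y = 0") (simp_all add: ip_diff_right ip_scale_right c_def)
  have "ip (x - smul c y) (smul c y) = 0"
    using ip_zero_commute[OF o] by (simp add: ip_scale_right)
  from pythagoras[OF this]
  show "(norm x)\<^sup>2 = (norm (x - smul c y))\<^sup>2 + (norm (smul c y))\<^sup>2" by simp
qed

lemma Cauchy_Schwarz: "norm (ip x y) \<le> norm x * norm y"
proof (cases "x = 0")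
  case False
  have "(norm (smul (ip x y / ip x x) x))\<^sup>2 \<le> (norm y)\<^sup>2"
    using orthogonal_component(2)[of y x] by simp
  then have "norm (smul (ip x y / ip x x) x) \<le> norm y"
    by (simp add: power2_le_iff_abs_le)
  then show ?thesis
    using False by (simp add: norm_scale norm_divide ip_norm power2_eq_square norm_mult field_simps)
qed simp

lemma bounded_linear_ip_right: "bounded_linear (ip x)"
proof (rule bounded_linear_intro)
  show "norm (ip x y) \<le> norm y * norm x" for y
    using Cauchy_Schwarz[of x y] by (simp add: mult.commute)
  show "ip x (r *\<^sub>R y) = r *\<^sub>R ip x y" for r y
    by (simp flip: scale_of_real add: ip_scale_right scaleR_conv_of_real)
qed (rule ip_add_right)

section \<open>Weak convergence and orthogonal projections\<close>

lemma tendsto_ip_left: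
  assumes "\<And>z. (\<lambda>n. ip z (y n)) \<longlonglongrightarrow> ip z l"
  shows "(\<lambda>n. ip (y n) z) \<longlonglongrightarrow> ip l z"
  using tendsto_kcnj[OF assms[of z]] by (simp flip: ip_commute)

lemma weakly_tendsto_ip:
  assumes "weakly_tendsto smul y l"
  shows "(\<lambda>n. ip z (y n)) \<longlonglongrightarrow> ip z l"
proof -
  have "ip z \<in> dual_space smul UNIV norm"
    using Cauchy_Schwarz by (auto simp: dual_space_def extensional_def ip_add_right ip_scale_right)
  then show ?thesis using assms unfolding weakly_tendsto_def by blast
qed

text \<open>Uniform boundedness applies to the functionals \<open>ip (y n)\<close>, linear because
  the sequence sits in the first argument. Evaluating the bound at \<open>y n\<close> itself
  controls \<open>norm (y n)\<close>.\<close>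

lemma weakly_convergent_bounded:
  assumes "\<And>z. (\<lambda>n. ip z (y n)) \<longlonglongrightarrow> ip z l"
  obtains C where "0 \<le> C" "\<And>n. norm (y n) \<le> C"
proof -
  have "bounded (range (\<lambda>n. ip (y n) z))" for z
    using tendsto_ip_left[OF assms] by (intro convergent_imp_bounded)
  then obtain C where C: "\<And>n x. norm (ip (y n) x) \<le> C * norm x"
    using uniform_boundedness[OF bounded_linear_ip_right] by metis
  have "norm (y n) \<le> \<bar>C\<bar>" for n
  proof (cases "y n = 0")
    case False
    have "norm (y n) * norm (y n) \<le> C * norm (y n)"
      using C[of n "y n"] by (simp add: ip_norm power2_eq_square norm_mult)
    with False show ?thesis by simp
  qed simp
  then show thesis using that abs_ge_zero by blast
qed

text \<open>Replacing \<open>x n\<close> by \<open>a\<close> costs at most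
  \<open>norm (x n - a) * C\<close>, where \<open>C\<close> bounds the weakly convergent
  factor.\<close>

lemma tendsto_ip_strong_weak:
  assumes x: "x \<longlonglongrightarrow> a" and y: "\<And>z. (\<lambda>n. ip z (y n)) \<longlonglongrightarrow> ip z l"
  shows "(\<lambda>n. ip (x n) (y n)) \<longlonglongrightarrow> ip a l"
proof -
  obtain C where C: "\<And>n. norm (y n) \<le> C" using weakly_convergent_bounded[OF y] by metis
  have "(\<lambda>n. ip (x n - a) (y n)) \<longlonglongrightarrow> 0"
  proof (rule Lim_null_comparison)
    show "\<forall>\<^sub>F n in sequentially. norm (ip (x n - a) (y n)) \<le> norm (x n - a) * C"
      using C by (intro always_eventually allI order_trans[OF Cauchy_Schwarz] mult_left_mono) auto
    show "(\<lambda>n. norm (x n - a) * C) \<longlonglongrightarrow> 0"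
      using x by (intro tendsto_mult_left_zero tendsto_norm_zero LIM_zero)
  qed
  from tendsto_add[OF this y[of a]] show ?thesis by (simp add: ip_diff_left)
qed

text \<open>A minimizing sequence for the distance from \<open>x\<close> to \<open>M\<close> is
  Cauchy by the parallelogram law, and its limit, a nearest point, leaves an orthogonal
  remainder.\<close>

lemma ex_projection:
  assumes M: "subspace M" and cl: "closed M"
  shows "\<exists>p\<in>M. \<forall>m\<in>M. ip m (x - p) = 0"
proof -
  define d where "d = infdist x M"
  have ne: "M \<noteq> {}" using subspace_0[OF M] by blast
  have d0: "0 \<le> d" unfolding d_def by (rule infdist_nonneg)
  have low: "d \<le> norm (x - m)" if "m \<in> M" for m
    using infdist_le[OF that, of x] by (simp add: d_def dist_norm)
  have "\<exists>m\<in>M. (norm (x - m))\<^sup>2 < d\<^sup>2 + 1 / real (Suc k)" for k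
  proof (rule ccontr)
    assume "\<not> ?thesis"
    then have "sqrt (d\<^sup>2 + 1 / real (Suc k)) \<le> dist x m" if "m \<in> M" for m
      using that by (auto simp: dist_norm not_less intro!: real_le_lsqrt)
    then have "sqrt (d\<^sup>2 + 1 / real (Suc k)) \<le> d"
      unfolding d_def infdist_notempty[OF ne] using ne by (intro cINF_greatest)
    moreover have "sqrt (d\<^sup>2) < sqrt (d\<^sup>2 + 1 / real (Suc k))"
      by (intro real_sqrt_less_mono) simp
    ultimately show False using d0 by simp
  qed
  then obtain s where sM: "\<And>k. s k \<in> M" and s: "\<And>k. (norm (x - s k))\<^sup>2 < d\<^sup>2 + 1 / real (Suc k)"
    by metis
  have half: "(1 / 2) *\<^sub>R m \<in> M" if "m \<in> M" for m
    using subspace_scale[OF M that, of "of_real (1 / 2)"] unfolding scale_of_real .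
  \<comment> \<open>The midpoint of \<open>s j\<close> and \<open>s k\<close> lies in
    \<open>M\<close>, so the two remainders add up to a vector of norm at least
    \<open>2 * d\<close>. The parallelogram law then leaves only the excess terms for the
    difference.\<close>
  have close: "(norm (s j - s k))\<^sup>2 \<le> 2 / real (Suc j) + 2 / real (Suc k)" for j k
  proof -
    have "norm ((x - s j) + (x - s k)) = norm (2 *\<^sub>R (x - (1 / 2) *\<^sub>R (s j + s k)))"
      by (simp add: algebra_simps scaleR_2)
    then have "norm ((x - s j) + (x - s k)) = 2 * norm (x - (1 / 2) *\<^sub>R (s j + s k))" by simp
    moreover have "d \<le> norm (x - (1 / 2) *\<^sub>R (s j + s k))"
      by (intro low half subspace_add[OF M] sM)
    ultimately have "2 * d \<le> norm ((x - s j) + (x - s k))" by linarith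
    then have "4 * d\<^sup>2 \<le> (norm ((x - s j) + (x - s k)))\<^sup>2"
      using power_mono[of "2 * d" _ 2] d0 by (simp add: power_mult_distrib)
    then show ?thesis
      using parallelogram[of "x - s j" "x - s k"] s[of j] s[of k] by (simp add: norm_minus_commute)
  qed
  have "Cauchy s"
  proof (rule metric_CauchyI)
    fix e :: real assume e: "0 < e"
    obtain N :: nat where N: "4 / e\<^sup>2 < real N" using reals_Archimedean2 by blast
    have "dist (s j) (s k) < e" if jk: "N \<le> j" "N \<le> k" for j k
    proof -
      have *: "2 / real (Suc i) < e\<^sup>2 / 2" if "N \<le> i" for i
      proof -
        have "4 / e\<^sup>2 < real (Suc i)" using N that by simp
        then show ?thesis using e by (simp add: field_simps)
      qed
      have "(norm (s j - s k))\<^sup>2 < e\<^sup>2" using close[of j k] *[OF jk(1)] *[OF jk(2)] by simp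
      then show ?thesis using e by (simp add: dist_norm power2_less_imp_less)
    qed
    then show "\<exists>N. \<forall>j\<ge>N. \<forall>k\<ge>N. dist (s j) (s k) < e" by blast
  qed
  then obtain p where p: "s \<longlonglongrightarrow> p" using Cauchy_convergent convergent_def by blast
  have pM: "p \<in> M" using closed_sequentially[OF cl sM p] .
  have "(norm (x - p))\<^sup>2 \<le> d\<^sup>2 + 0"
  proof (rule LIMSEQ_le)
    show "(\<lambda>k. (norm (x - s k))\<^sup>2) \<longlonglongrightarrow> (norm (x - p))\<^sup>2" by (intro tendsto_intros p)
    show "(\<lambda>k. d\<^sup>2 + 1 / real (Suc k)) \<longlonglongrightarrow> d\<^sup>2 + 0"
      by (intro tendsto_intros LIMSEQ_Suc lim_1_over_n)
  qed (use s less_imp_le in blast)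
  then have min: "(norm (x - p))\<^sup>2 \<le> (norm (x - m))\<^sup>2" if "m \<in> M" for m
    using power_mono[OF low[OF that] d0, of 2] by linarith
  have "ip m (x - p) = 0" if m: "m \<in> M" for m
  proof -
    \<comment> \<open>Moving from \<open>p\<close> to \<open>p + smul ?c m\<close> would lower the
      squared distance to \<open>x\<close> by the squared norm of \<open>smul ?c m\<close>; as
      \<open>p\<close> is nearest, that vector is zero.\<close>
    let ?c = "ip m (x - p) / ip m m"
    have "(norm (x - p))\<^sup>2 \<le> (norm (x - p - smul ?c m))\<^sup>2"
      using min[of "p + smul ?c m"] subspace_add[OF M pM subspace_scale[OF M m]]
      by (simp only: diff_diff_eq)
    then have "smul ?c m = 0" using orthogonal_component(2)[of "x - p" m] by simp
    then show ?thesis by auto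
  qed
  with pM show ?thesis by blast
qed

text \<open>The point is merely chosen; later arguments work through membership in \<open>M\<close>,
  orthogonality of the remainder and self-adjointness.\<close>

definition proj :: "'a set \<Rightarrow> 'a \<Rightarrow> 'a"
  where "proj M x = (SOME p. p \<in> M \<and> (\<forall>m\<in>M. ip m (x - p) = 0))"

lemma
  assumes "subspace M" and "closed M"
  shows proj_in: "proj M x \<in> M" and proj_orthogonal: "m \<in> M \<Longrightarrow> ip m (x - proj M x) = 0"
proof -
  have "proj M x \<in> M \<and> (\<forall>m\<in>M. ip m (x - proj M x) = 0)"
    unfolding proj_def by (rule someI_ex) (use ex_projection[OF assms, of x] in blast)
  then show "proj M x \<in> M" "m \<in> M \<Longrightarrow> ip m (x - proj M x) = 0" by auto
qed

lemma ip_proj_right: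
  assumes "subspace M" and "closed M"
  shows "m \<in> M \<Longrightarrow> ip m (proj M x) = ip m x"
  using proj_orthogonal[OF assms, of m x] by (simp add: ip_diff_right)

lemma ip_proj_left:
  assumes "subspace M" and "closed M"
  shows "m \<in> M \<Longrightarrow> ip (proj M x) m = ip x m"
  by (metis assms ip_commute ip_proj_right)

text \<open>Both sides equal \<open>ip (proj M x) (proj M y)\<close>. This carries weak convergence
  through a projection, by moving it onto the fixed test vector.\<close>

lemma ip_proj_commute:
  assumes "subspace M" and "closed M"
  shows "ip (proj M x) y = ip x (proj M y)"
  by (metis assms ip_proj_left ip_proj_right proj_in)

definition orth :: "'a set \<Rightarrow> 'a set"
  where "orth M = {x. \<forall>m\<in>M. ip m x = 0}"

lemma subspace_orth: "subspace (orth M)"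
  by (auto simp: orth_def subspace_def ip_add_right ip_scale_right)

text \<open>Gram-Schmidt by induction on \<open>B\<close>, carrying orthonormality of
  \<open>E\<close> along. The vectors that satisfy the expansion form a subspace, which therefore
  contains \<open>span B\<close>.\<close>

lemma orthonormal_expansion:
  assumes "finite B"
  shows "\<exists>E. finite E \<and> (\<forall>z\<in>span B. z = (\<Sum>e\<in>E. smul (ip e z) e))"
proof -
  let ?exp = "\<lambda>E z. z = (\<Sum>e\<in>E. smul (ip e z) e)"
  have "\<exists>E. finite E \<and> (\<forall>e\<in>E. \<forall>f\<in>E. ip e f = (if e = f then 1 else 0)) \<and> (\<forall>b\<in>B. ?exp E b)"
    using assms
  proof (induction B rule: finite_induct)
    case empty
    then show ?case by (intro exI[of _ "{}"]) auto
  next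
    case (insert b B)
    then obtain E where E: "finite E" "\<And>e f. e \<in> E \<Longrightarrow> f \<in> E \<Longrightarrow> ip e f = (if e = f then 1 else 0)"
      "\<And>b. b \<in> B \<Longrightarrow> ?exp E b" by blast
    \<comment> \<open>If this remainder of \<open>b\<close> vanishes, \<open>E\<close> already
      expands \<open>b\<close>; otherwise its normalization \<open>f\<close> joins
      \<open>E\<close>.\<close>
    define r where "r = b - (\<Sum>e\<in>E. smul (ip e b) e)"
    show ?case
    proof (cases "r = 0")
      case True
      then show ?thesis using E by (intro exI[of _ E]) (auto simp: r_def)
    next
      case False
      define f where "f = smul (of_real (1 / norm r)) r"
      have er: "ip e r = 0" if e: "e \<in> E" for e
      proof -
        have "(\<Sum>i\<in>E. ip i b * ip e i) = (\<Sum>i\<in>E. if i = e then ip e b else 0)"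
          using E(2)[OF e] by (intro sum.cong) auto
        then show ?thesis
          using e E(1) by (simp add: r_def ip_diff_right ip_sum_right ip_scale_right)
      qed
      have ef: "ip e f = 0" "ip f e = 0" if "e \<in> E" for e
        using er[OF that] ip_zero_commute[OF er[OF that]] by (auto simp: f_def ip_scale_left ip_scale_right)
      have ff: "ip f f = 1"
        using False by (simp add: ip_norm f_def norm_scale norm_divide)
      have fE: "f \<notin> E" using ef ff by force
      have rf: "smul (of_real (norm r)) f = r"
        using False by (simp add: f_def flip: of_real_mult)
      \<comment> \<open>Since \<open>f\<close> is orthogonal to \<open>E\<close>,
        \<open>ip f b\<close> equals \<open>ip f r\<close>, which is \<open>norm r\<close>; hence
        \<open>smul (ip f b) f\<close> restores \<open>r\<close>.\<close>
      have "ip f (\<Sum>e\<in>E. smul (ip e b) e) = 0"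
        using ef by (simp add: ip_sum_right ip_scale_right)
      then have "ip f b = ip f r" by (simp add: r_def ip_diff_right)
      also have "\<dots> = of_real (norm r)"
        by (subst rf[symmetric]) (simp add: ip_scale_right ff)
      finally have "smul (ip f b) f = r" using rf by simp
      then have 1: "?exp (insert f E) b"
        using E(1) fE by (simp add: r_def)
      have 2: "?exp (insert f E) z" if "z \<in> B" for z
      proof -
        have "ip f z = ip f (\<Sum>e\<in>E. smul (ip e z) e)" using E(3)[OF that] by simp
        also have "\<dots> = 0" using ef by (simp add: ip_sum_right ip_scale_right)
        finally show ?thesis using E(1) E(3)[OF that] fE by simp
      qed
      have "\<forall>e\<in>insert f E. \<forall>g\<in>insert f E. ip e g = (if e = g then 1 else 0)"
        using E(2) ef ff fE by auto
      with 1 2 E(1) show ?thesis by (intro exI[of _ "insert f E"]) blast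
    qed
  qed
  then obtain E where E: "finite E" "\<And>b. b \<in> B \<Longrightarrow> ?exp E b" by blast
  have "subspace {z. ?exp E z}"
  proof (rule subspaceI)
    fix c z assume z: "z \<in> {z. ?exp E z}"
    have "(\<Sum>e\<in>E. smul (ip e (smul c z)) e) = smul c (\<Sum>e\<in>E. smul (ip e z) e)"
      by (simp add: scale_sum_right ip_scale_right)
    also have "(\<Sum>e\<in>E. smul (ip e z) e) = z" using z by simp
    finally show "smul c z \<in> {z. ?exp E z}" by simp
  qed (simp_all add: ip_add_right scale_left_distrib sum.distrib)
  then have "span B \<subseteq> {z. ?exp E z}" using E(2) by (intro span_minimal) auto
  with E(1) show ?thesis by blast
qed

end

subsection \<open>Operators with closed range\<close>

text \<open>Otherwise some subsequence stays at distance at least \<open>e\<close> from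
  \<open>l\<close>, yet compactness gives it a convergent subsequence, whose limit is
  \<open>l\<close> by \<open>unique\<close>.\<close>

lemma (in Metric_space) relatively_compact_imp_limit:
  assumes rc: "relatively_compactin mtopology (range f)" and l: "l \<in> M"
    and unique: "\<And>r l'. strict_mono r \<Longrightarrow> limitin mtopology (f \<circ> r) l' sequentially \<Longrightarrow> l' = l"
  shows "(\<lambda>n. d (f n) l) \<longlonglongrightarrow> 0"
proof (rule ccontr)
  assume "\<not> ?thesis"
  then obtain e where e: "0 < e" and "\<not> (\<forall>\<^sub>F n in sequentially. d (f n) l < e)"
    unfolding tendsto_iff by auto
  then have "infinite {n. e \<le> d (f n) l}"
    unfolding eventually_sequentially infinite_nat_iff_unbounded_le by (auto simp: not_less)
  then obtain r :: "nat \<Rightarrow> nat" where r: "strict_mono r" "\<And>n. e \<le> d (f (r n)) l"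
    using infinite_enumerate by blast
  have "range f \<subseteq> mtopology closure_of (range f)"
    using rc by (intro closure_of_subset) (simp add: relatively_compactin_def)
  then have "range (f \<circ> r) \<subseteq> mtopology closure_of (range f)" by auto
  moreover have "compactin mtopology (mtopology closure_of (range f))"
    using rc by (simp add: relatively_compactin_def)
  ultimately obtain l' q where q: "strict_mono q" "limitin mtopology ((f \<circ> r) \<circ> q) l' sequentially"
    unfolding compactin_sequentially by blast
  have "strict_mono (r \<circ> q)" using r(1) q(1) by (rule strict_mono_o)
  from unique[OF this] q(2) have "l' = l" by (simp add: comp_assoc)
  with q(2) have "(\<lambda>n. d (f (r (q n))) l) \<longlonglongrightarrow> 0"
    by (simp add: limitin_metric_dist_null comp_def)
  then have "\<forall>\<^sub>F n in sequentially. d (f (r (q n))) l < e"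
    using e by (rule order_tendstoD)
  then show False using r(2) by (auto simp: eventually_sequentially not_less[symmetric])
qed

text \<open>Scaling \<open>x\<close> into the unit ball of \<open>N\<close> reduces the claim to the
  supremum in \<open>dual_norm\<close>, an upper bound only once the values are known to be bounded.
  If \<open>N x = 0\<close>, boundedness of the functionals makes the difference vanish.\<close>

lemma norm_diff_le_dual_dist:
  fixes smul :: "'k::real_normed_field \<Rightarrow> 'a::ab_group_add \<Rightarrow> 'a"
  assumes D: "module.subspace smul D" and "vector_space smul"
    and N0: "\<And>x. x \<in> D \<Longrightarrow> 0 \<le> N x"
    and Ns: "\<And>c x. x \<in> D \<Longrightarrow> N (smul c x) = norm c * N x"
    and pq: "\<phi> \<in> dual_space smul D N" "\<psi> \<in> dual_space smul D N" and x: "x \<in> D"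
  shows "norm (\<phi> x - \<psi> x) \<le> dual_dist smul D N \<phi> \<psi> * N x"
proof -
  interpret vector_space smul by fact
  obtain C E where C: "\<forall>x\<in>D. norm (\<phi> x) \<le> C * N x" and E: "\<forall>x\<in>D. norm (\<psi> x) \<le> E * N x"
    using pq unfolding dual_space_def by blast
  have CE: "norm (\<phi> y - \<psi> y) \<le> (\<bar>C\<bar> + \<bar>E\<bar>) * N y" if y: "y \<in> D" for y
  proof -
    have "C * N y \<le> \<bar>C\<bar> * N y" "E * N y \<le> \<bar>E\<bar> * N y"
      using N0[OF y] by (simp_all add: mult_right_mono)
    moreover have "norm (\<phi> y) \<le> C * N y" "norm (\<psi> y) \<le> E * N y" using C E y by auto
    ultimately show ?thesis
      using norm_triangle_ineq4[of "\<phi> y" "\<psi> y"] by (simp add: distrib_right)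
  qed
  show ?thesis
  proof (cases "N x = 0")
    case True
    then show ?thesis using CE[OF x] by simp
  next
    case False
    then have pos: "0 < N x" using N0[OF x] by simp
    define c :: 'k where "c = of_real (1 / N x)"
    have c: "norm c = 1 / N x" using pos by (simp add: c_def norm_divide)
    have cx: "smul c x \<in> {x \<in> D. N x \<le> 1}"
      using subspace_scale[OF D x] pos by (simp add: Ns[OF x] c)
    have bdd: "bdd_above ((\<lambda>x. norm (\<phi> x - \<psi> x)) ` {x \<in> D. N x \<le> 1})"
    proof (rule bdd_aboveI2)
      fix y assume y: "y \<in> {x \<in> D. N x \<le> 1}"
      have "norm (\<phi> y - \<psi> y) \<le> (\<bar>C\<bar> + \<bar>E\<bar>) * N y" using CE y by blast
      also have "\<dots> \<le> (\<bar>C\<bar> + \<bar>E\<bar>) * 1" using y by (intro mult_left_mono) auto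
      finally show "norm (\<phi> y - \<psi> y) \<le> (\<bar>C\<bar> + \<bar>E\<bar>) * 1" .
    qed
    have "norm (\<phi> (smul c x) - \<psi> (smul c x)) \<le> dual_dist smul D N \<phi> \<psi>"
      using cSUP_upper[OF cx bdd] pq by (simp add: dual_dist_def dual_norm_def)
    moreover have "\<phi> (smul c x) - \<psi> (smul c x) = c * (\<phi> x - \<psi> x)"
      using pq x by (simp add: dual_space_def right_diff_distrib)
    ultimately have "norm c * norm (\<phi> x - \<psi> x) \<le> dual_dist smul D N \<phi> \<psi>"
      by (simp only: norm_mult)
    then show ?thesis using pos by (simp add: c field_simps)
  qed
qed

text \<open>The algebraic part of \<open>densely_defined_closed_linear\<close>, split off so that an
  adjoint becomes an instance of \<open>hilbert_op\<close> by linearity alone.\<close>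

definition linear_op ::
  "('k::field \<Rightarrow> 'a::ab_group_add \<Rightarrow> 'a) \<Rightarrow> ('k \<Rightarrow> 'b::ab_group_add \<Rightarrow> 'b) \<Rightarrow> ('a, 'b) partial_op \<Rightarrow> bool"
  where "linear_op smul smul' A \<longleftrightarrow>
    module.subspace smul (domain A) \<and>
    (\<forall>x\<in>domain A. \<forall>y\<in>domain A. app A (x + y) = app A x + app A y) \<and>
    (\<forall>c. \<forall>x\<in>domain A. app A (smul c x) = smul' c (app A x))"

lemma densely_defined_closed_linearD:
  assumes "densely_defined_closed_linear smul smul' A"
  shows "linear_op smul smul' A" "closure (domain A) = UNIV" "closed (op_graph A)"
  using assms by (auto simp: densely_defined_closed_linear_def linear_op_def)

section \<open>Linear operators between Hilbert spaces and their weak functionals\<close>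

locale hilbert_op = dom: hilbert_space smul ip + cod: hilbert_space smul' ip'
  for smul :: "'k::real_or_complex \<Rightarrow> 'a::banach \<Rightarrow> 'a" and ip
    and smul' :: "'k \<Rightarrow> 'b::banach \<Rightarrow> 'b" and ip' +
  fixes A :: "('a, 'b) partial_op"
  assumes linear_op: "linear_op smul smul' A"
begin

lemma subspace_domain: "dom.subspace (domain A)"
  and app_add: "x \<in> domain A \<Longrightarrow> y \<in> domain A \<Longrightarrow> app A (x + y) = app A x + app A y"
  and app_scale: "x \<in> domain A \<Longrightarrow> app A (smul c x) = smul' c (app A x)"
  using linear_op by (auto simp: linear_op_def)

lemma app_zero: "app A 0 = 0"
  using app_scale[OF dom.subspace_0[OF subspace_domain], of 0] by simp

lemma app_diff:
  assumes "x \<in> domain A" "y \<in> domain A"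
  shows "app A (x - y) = app A x - app A y"
  using app_add[OF dom.subspace_diff[OF subspace_domain assms] assms(2)] by simp

lemma subspace_ran: "cod.subspace (op_ran A)"
proof (rule cod.subspaceI)
  show "0 \<in> op_ran A"
    unfolding op_ran_def using app_zero dom.subspace_0[OF subspace_domain] by (metis imageI)
next
  fix x y assume "x \<in> op_ran A" "y \<in> op_ran A"
  then obtain x' y' where "x' \<in> domain A" "y' \<in> domain A" "x = app A x'" "y = app A y'"
    unfolding op_ran_def by blast
  then show "x + y \<in> op_ran A"
    unfolding op_ran_def using app_add dom.subspace_add[OF subspace_domain] by (metis imageI)
next
  fix c x assume "x \<in> op_ran A"
  then obtain x' where "x' \<in> domain A" "x = app A x'"
    unfolding op_ran_def by blast
  then show "smul' c x \<in> op_ran A"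
    unfolding op_ran_def using app_scale dom.subspace_scale[OF subspace_domain] by (metis imageI)
qed

lemma subspace_ker: "dom.subspace (op_ker A)"
  using subspace_domain app_zero
  by (auto simp: op_ker_def dom.subspace_def app_add app_scale)

lemma closed_ker:
  assumes "closed (op_graph A)"
  shows "closed (op_ker A)"
proof -
  have "op_ker A = (\<lambda>x. (x, 0)) -` op_graph A"
    by (auto simp: op_ker_def op_graph_def)
  then show ?thesis using assms by (simp add: closed_vimage continuous_on_Pair)
qed

lemma graph_norm_nonneg: "0 \<le> graph_norm A x"
  by (simp add: graph_norm_def)

lemma graph_norm_scale:
  assumes "x \<in> domain A"
  shows "graph_norm A (smul c x) = norm c * graph_norm A x"
  by (simp add: graph_norm_def app_scale[OF assms] dom.norm_scale cod.norm_scale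
      power_mult_distrib real_sqrt_mult flip: distrib_left)

lemma norm_app_le_graph_norm: "norm (app A x) \<le> graph_norm A x"
  by (simp add: graph_norm_def real_le_rsqrt)

lemma weak_functional_in_dual:
  "weak_functional ip' A u \<in> dual_space smul (domain A) (graph_norm A)"
proof -
  have "norm (ip' u (app A x)) \<le> norm u * graph_norm A x" for x
    using cod.Cauchy_Schwarz norm_app_le_graph_norm
    by (meson mult_left_mono norm_ge_zero order_trans)
  then show ?thesis
    using dom.subspace_add[OF subspace_domain] dom.subspace_scale[OF subspace_domain]
    by (auto simp: dual_space_def weak_functional_def app_add app_scale
        cod.ip_add_right cod.ip_scale_right)
qed

text \<open>\<open>a n\<close> and \<open>b\<close> are the projections of \<open>u n\<close> and
  \<open>l\<close> onto \<open>M\<close>, described by orthogonality so that \<open>M\<close> can be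
  a range or the orthogonal complement of a kernel. Testing the functionals at a bounded preimage of
  \<open>a n - b\<close> turns dual-norm convergence into strong convergence.\<close>

lemma tendsto_component:
  assumes rc: "relatively_compactin (dual_topology smul (domain A) (graph_norm A))
      (range (\<lambda>n. weak_functional ip' A (u n)))"
    and u: "\<And>z. (\<lambda>n. ip' z (u n)) \<longlonglongrightarrow> ip' z l"
    and M: "cod.subspace M"
    and C: "0 \<le> C"
    and lift: "\<And>y. y \<in> M \<Longrightarrow> \<exists>x\<in>domain A. app A x = y \<and> norm x \<le> C * norm y"
    and a: "\<And>n. a n \<in> M" "\<And>n m. m \<in> M \<Longrightarrow> ip' m (u n - a n) = 0"
    and b: "b \<in> M" "\<And>m. m \<in> M \<Longrightarrow> ip' m (l - b) = 0"
  shows "a \<longlonglongrightarrow> b"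
proof -
  let ?D = "dual_space smul (domain A) (graph_norm A)"
  let ?d = "dual_dist smul (domain A) (graph_norm A)"
  let ?f = "\<lambda>n. weak_functional ip' A (u n)" and ?g = "weak_functional ip' A l"
  interpret Metric_space ?D ?d
    by (intro Metric_space_dual_space subspace_domain dom.vector_space_axioms graph_norm_nonneg graph_norm_scale)
  have upper: "norm (\<phi> x - \<psi> x) \<le> ?d \<phi> \<psi> * graph_norm A x"
    if "\<phi> \<in> ?D" "\<psi> \<in> ?D" "x \<in> domain A" for \<phi> \<psi> x
    using that
    by (intro norm_diff_le_dual_dist subspace_domain dom.vector_space_axioms graph_norm_nonneg graph_norm_scale)
  have lim: "(\<lambda>n. ?d (?f n) ?g) \<longlonglongrightarrow> 0"
  proof (rule relatively_compact_imp_limit)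
    show "relatively_compactin mtopology (range ?f)" using rc by (simp add: dual_topology_def)
    show "?g \<in> ?D" by (rule weak_functional_in_dual)
    fix r :: "nat \<Rightarrow> nat" and h
    assume r: "strict_mono r" and "limitin mtopology (?f \<circ> r) h sequentially"
    then have h: "h \<in> ?D" and d0: "(\<lambda>n. ?d (?f (r n)) h) \<longlonglongrightarrow> 0"
      by (auto simp: limitin_metric_dist_null comp_def)
    \<comment> \<open>Dual-norm convergence implies pointwise convergence on the domain, where weak
      convergence of \<open>u\<close> identifies the limit.\<close>
    show "h = ?g"
    proof (rule extensionalityI[of _ "domain A"])
      show "h \<in> extensional (domain A)" using h by (simp add: dual_space_def)
      show "?g \<in> extensional (domain A)" by (simp add: weak_functional_def)
      fix x assume x: "x \<in> domain A"
      have "(\<lambda>n. ?f (r n) x - h x) \<longlonglongrightarrow> 0"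
      proof (rule Lim_null_comparison)
        show "\<forall>\<^sub>F n in sequentially. norm (?f (r n) x - h x) \<le> ?d (?f (r n)) h * graph_norm A x"
          using upper[OF weak_functional_in_dual h x] by (intro always_eventually allI)
        show "(\<lambda>n. ?d (?f (r n)) h * graph_norm A x) \<longlonglongrightarrow> 0"
          using d0 by (rule tendsto_mult_left_zero)
      qed
      then have "(\<lambda>n. ip' (u (r n)) (app A x)) \<longlonglongrightarrow> h x"
        using x by (simp add: weak_functional_def LIM_zero_iff)
      moreover have "(\<lambda>n. ip' (u (r n)) (app A x)) \<longlonglongrightarrow> ip' l (app A x)"
        using LIMSEQ_subseq_LIMSEQ[OF cod.tendsto_ip_left[OF u] r] by (simp add: comp_def)
      ultimately show "h x = ?g x"
        using x LIMSEQ_unique by (auto simp: weak_functional_def)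
    qed
  qed
  have bound: "norm (a n - b) \<le> ?d (?f n) ?g * (C + 1)" for n
  proof (cases "a n = b")
    case True
    then show ?thesis using C by simp
  next
    case False
    define y where "y = a n - b"
    have y: "y \<in> M" unfolding y_def using a(1) b(1) by (rule cod.subspace_diff[OF M])
    from lift[OF this] obtain x where x: "x \<in> domain A" "app A x = y" "norm x \<le> C * norm y"
      by blast
    \<comment> \<open>Both remainders are orthogonal to \<open>y\<close>, so testing
      \<open>u n - l\<close> against \<open>y\<close> yields the squared norm of \<open>y\<close>,
      which is the difference of the functionals at \<open>x\<close>.\<close>
    have "ip' y ((u n - a n) - (l - b)) = 0"
      using a(2)[OF y] b(2)[OF y] by (simp only: cod.ip_diff_right[of y "u n - a n"]) simp
    moreover have "(u n - a n) - (l - b) = (u n - l) - y" by (simp add: y_def)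
    ultimately have "ip' y ((u n - l) - y) = 0" by simp
    then have "ip' y (u n - l) = ip' y y" by (simp add: cod.ip_diff_right[of y "u n - l"])
    then have "ip' (u n - l) y = ip' y y" by (metis cod.ip_commute)
    then have "of_real ((norm y)\<^sup>2) = ?f n x - ?g x"
      using x by (simp add: weak_functional_def cod.ip_diff_left cod.ip_norm)
    then have "(norm y)\<^sup>2 = norm (?f n x - ?g x)"
      by (metis norm_of_real abs_power2 of_real_power)
    also have "\<dots> \<le> ?d (?f n) ?g * graph_norm A x"
      by (rule upper[OF weak_functional_in_dual weak_functional_in_dual x(1)])
    also have "\<dots> \<le> ?d (?f n) ?g * ((C + 1) * norm y)"
    proof (rule mult_left_mono[OF _ nonneg])
      \<comment> \<open>The part \<open>app A x = y\<close> of the graph norm accounts for the 1 in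
        \<open>C + 1\<close>.\<close>
      have "graph_norm A x \<le> norm x + norm y"
        unfolding graph_norm_def x(2) by (rule sqrt_sum_squares_le_sum) auto
      then show "graph_norm A x \<le> (C + 1) * norm y" using x(3) by (simp add: distrib_right)
    qed
    finally have "norm y * norm y \<le> (?d (?f n) ?g * (C + 1)) * norm y"
      by (simp add: power2_eq_square mult.assoc)
    moreover have "0 < norm y" using False by (simp add: y_def)
    ultimately show ?thesis by (simp add: y_def)
  qed
  show "a \<longlonglongrightarrow> b"
  proof (rule LIM_zero_cancel, rule Lim_null_comparison)
    show "\<forall>\<^sub>F n in sequentially. norm (a n - b) \<le> ?d (?f n) ?g * (C + 1)"
      using bound by (intro always_eventually allI)
    show "(\<lambda>n. ?d (?f n) ?g * (C + 1)) \<longlonglongrightarrow> 0" using lim by (rule tendsto_mult_left_zero)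
  qed
qed

text \<open>The open mapping theorem for the graph, viewed as a real subspace; passing to
  \<open>\<bar>C\<bar>\<close> makes the constant nonnegative.\<close>

lemma bounded_lift:
  assumes "closed (op_graph A)" and "closed (op_ran A)"
  obtains C where "0 \<le> C" "\<And>y. y \<in> op_ran A \<Longrightarrow> \<exists>x\<in>domain A. app A x = y \<and> norm x \<le> C * norm y"
proof -
  have ran: "snd ` op_graph A = op_ran A" by (force simp: op_graph_def op_ran_def)
  have "Real_Vector_Spaces.subspace (op_graph A)"
  proof (rule Real_Vector_Spaces.subspaceI)
    show "0 \<in> op_graph A"
      using app_zero dom.subspace_0[OF subspace_domain] by (auto simp: op_graph_def zero_prod_def)
  next
    fix p q assume "p \<in> op_graph A" "q \<in> op_graph A"
    then show "p + q \<in> op_graph A"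
      using dom.subspace_add[OF subspace_domain] by (auto simp: op_graph_def app_add)
  next
    fix c p assume "p \<in> op_graph A"
    then show "c *\<^sub>R p \<in> op_graph A"
      using dom.subspace_scale[OF subspace_domain, of _ "of_real c"]
        app_scale[of _ "of_real c"]
      by (auto simp: op_graph_def dom.scale_of_real cod.scale_of_real)
  qed
  from open_mapping[OF this assms(1)] assms(2) obtain C
    where C: "\<And>y. y \<in> op_ran A \<Longrightarrow> \<exists>x. (x, y) \<in> op_graph A \<and> norm x \<le> C * norm y"
    unfolding ran by blast
  show thesis
  proof
    fix y assume "y \<in> op_ran A"
    from C[OF this] obtain x where x: "x \<in> domain A" "app A x = y" "norm x \<le> C * norm y"
      by (auto simp: op_graph_def)
    moreover have "C * norm y \<le> \<bar>C\<bar> * norm y" by (intro mult_right_mono) auto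
    ultimately show "\<exists>x\<in>domain A. app A x = y \<and> norm x \<le> \<bar>C\<bar> * norm y"
      by (intro bexI[of _ x]) auto
  qed simp
qed

end

section \<open>Adjoints of densely defined operators\<close>

locale dense_hilbert_op = hilbert_op +
  assumes dense: "closure (domain A) = UNIV"
begin

text \<open>The vectors orthogonal to \<open>z\<close> form a closed set, so by density
  \<open>z\<close> is among them. This is what makes the \<open>THE\<close> in
  \<open>adjoint_op\<close> unique.\<close>

lemma eq_zero_if_orthogonal_domain:
  assumes "\<And>x. x \<in> domain A \<Longrightarrow> ip z x = 0"
  shows "z = 0"
proof -
  have "closed {x. ip z x = 0}"
    by (intro closed_Collect_eq continuous_intros bounded_linear.continuous_on[OF dom.bounded_linear_ip_right])
  then have "closure (domain A) \<subseteq> {x. ip z x = 0}"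
    using assms by (intro closure_minimal) auto
  then have "ip z z = 0" unfolding dense by blast
  then show ?thesis by simp
qed

lemma adjoint_op_unique:
  assumes "\<forall>x\<in>domain A. ip' y (app A x) = ip z x" "\<forall>x\<in>domain A. ip' y (app A x) = ip z' x"
  shows "z = z'"
  using eq_zero_if_orthogonal_domain[of "z - z'"] assms by (simp add: dom.ip_diff_left)

abbreviation "adj \<equiv> adjoint_op ip ip' A"

lemma adjoint_opI:
  assumes "\<And>x. x \<in> domain A \<Longrightarrow> ip' y (app A x) = ip z x"
  shows "y \<in> domain adj" "app adj y = z"
proof -
  show "y \<in> domain adj" using assms by (auto simp: adjoint_op_def)
  have "(THE z. \<forall>x\<in>domain A. ip' y (app A x) = ip z x) = z"
    using assms adjoint_op_unique by (intro the_equality) blast+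
  then show "app adj y = z" by (simp add: adjoint_op_def)
qed

lemma ip_adjoint:
  assumes "y \<in> domain adj" "x \<in> domain A"
  shows "ip' y (app A x) = ip (app adj y) x"
proof -
  obtain z where z: "\<And>x. x \<in> domain A \<Longrightarrow> ip' y (app A x) = ip z x"
    using assms(1) by (auto simp: adjoint_op_def)
  then show ?thesis using adjoint_opI(2)[OF z] assms(2) by simp
qed

lemma hilbert_op_adj: "hilbert_op smul' ip' smul ip adj"
proof -
  have z: "0 \<in> domain adj" by (rule adjoint_opI[of _ 0]) simp
  have p: "x + y \<in> domain adj" "app adj (x + y) = app adj x + app adj y"
    if "x \<in> domain adj" "y \<in> domain adj" for x y
    using adjoint_opI[of "x + y" "app adj x + app adj y"] that
    by (simp_all add: ip_adjoint dom.ip_add_left cod.ip_add_left)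
  have s: "smul' c x \<in> domain adj" "app adj (smul' c x) = smul c (app adj x)"
    if "x \<in> domain adj" for c x
    using adjoint_opI[of "smul' c x" "smul c (app adj x)"] that
    by (simp_all add: ip_adjoint dom.ip_scale_left cod.ip_scale_left)
  have "linear_op smul' smul adj"
    unfolding linear_op_def using z p s by (simp add: cod.subspace_def)
  then show ?thesis
    by (intro hilbert_op.intro hilbert_op_axioms.intro dom.hilbert_space_axioms cod.hilbert_space_axioms)
qed

lemma orth_ran_subset_ker_adj: "cod.orth (op_ran A) \<subseteq> op_ker adj"
proof
  fix y assume "y \<in> cod.orth (op_ran A)"
  then have "ip' y (app A x) = ip 0 x" if "x \<in> domain A" for x
    using that by (auto simp: cod.orth_def op_ran_def intro: cod.ip_zero_commute)
  from adjoint_opI[OF this] show "y \<in> op_ker adj" by (simp add: op_ker_def)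
qed

text \<open>A quantitative part of the closed range theorem. For \<open>z\<close> orthogonal to the
  kernel, \<open>ip z x\<close> depends only on \<open>app A x\<close> and is bounded in it, so a
  Riesz representative \<open>w\<close> exists and satisfies \<open>app adj w = z\<close>.\<close>

lemma adjoint_lift:
  assumes gr: "closed (op_graph A)" and ran: "closed (op_ran A)"
  obtains C where "0 \<le> C" "\<And>z. z \<in> dom.orth (op_ker A) \<Longrightarrow>
    \<exists>w\<in>domain adj. app adj w = z \<and> norm w \<le> C * norm z"
proof -
  obtain C where C0: "0 \<le> C"
    and C: "\<And>y. y \<in> op_ran A \<Longrightarrow> \<exists>x\<in>domain A. app A x = y \<and> norm x \<le> C * norm y"
    using bounded_lift[OF gr ran] by blast
  have "\<exists>w\<in>domain adj. app adj w = z \<and> norm w \<le> C * norm z" if z: "z \<in> dom.orth (op_ker A)" for z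
  proof (cases "z = 0")
    case True
    then show ?thesis using adjoint_opI[of 0 0] by (intro bexI[of _ 0]) auto
  next
    case False
    have zker: "ip z x = 0" if "x \<in> domain A" "app A x = 0" for x
      using z that by (auto simp: dom.orth_def op_ker_def intro: dom.ip_zero_commute)
    \<comment> \<open>\<open>x\<close> may be replaced by a preimage \<open>x'\<close> of controlled
      norm: \<open>x - x'\<close> lies in the kernel, to which \<open>z\<close> is
      orthogonal.\<close>
    have zb: "norm (ip z x) \<le> norm z * (C * norm (app A x))" if x: "x \<in> domain A" for x
    proof -
      obtain x' where x': "x' \<in> domain A" "app A x' = app A x" "norm x' \<le> C * norm (app A x)"
        using C[of "app A x"] x by (auto simp: op_ran_def)
      have "ip z (x - x') = 0"
        using x x' dom.subspace_diff[OF subspace_domain] by (intro zker) (auto simp: app_diff)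
      then have "norm (ip z x) = norm (ip z x')" by (simp add: dom.ip_diff_right)
      also have "\<dots> \<le> norm z * norm x'" by (rule dom.Cauchy_Schwarz)
      also have "\<dots> \<le> norm z * (C * norm (app A x))" using x'(3) by (rule mult_left_mono) simp
      finally show ?thesis .
    qed
    txt \<open>Riesz representation of \<open>app A x \<mapsto> ip z x\<close>: \<open>K\<close> is its kernel, and a multiple \<open>w\<close> of a
      vector \<open>r\<close> orthogonal to \<open>K\<close> represents it.\<close>
    define K where "K = app A ` {x \<in> domain A. ip z x = 0}"
    have Ksub: "cod.subspace K"
    proof (rule cod.subspaceI)
      show "0 \<in> K" unfolding K_def
        using app_zero dom.subspace_0[OF subspace_domain] by (intro image_eqI[of _ _ 0]) auto
    next
      fix x y assume "x \<in> K" "y \<in> K"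
      then obtain x' y' where "x' \<in> domain A" "ip z x' = 0" "y' \<in> domain A" "ip z y' = 0"
        "x = app A x'" "y = app A y'" unfolding K_def by blast
      then show "x + y \<in> K" unfolding K_def
        by (intro image_eqI[of _ _ "x' + y'"])
           (auto simp: app_add dom.ip_add_right dom.subspace_add[OF subspace_domain])
    next
      fix c x assume "x \<in> K"
      then obtain x' where "x' \<in> domain A" "ip z x' = 0" "x = app A x'" unfolding K_def by blast
      then show "smul' c x \<in> K" unfolding K_def
        by (intro image_eqI[of _ _ "smul c x'"])
           (auto simp: app_scale dom.ip_scale_right dom.subspace_scale[OF subspace_domain])
    qed
    have Kran: "K \<subseteq> op_ran A" by (auto simp: K_def op_ran_def)
    have "closed K"
      unfolding closed_sequential_limits
    proof (intro allI impI, elim conjE)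
      fix s y assume s: "\<forall>n. s n \<in> K" and lim: "s \<longlonglongrightarrow> y"
      have "y \<in> op_ran A" using closed_sequentially[OF ran _ lim] s Kran by blast
      then obtain x where x: "x \<in> domain A" "y = app A x" unfolding op_ran_def by blast
      \<comment> \<open>By \<open>zb\<close> for \<open>x - x'\<close>, where
        \<open>ip z x' = 0\<close>, the fixed number \<open>ip z x\<close> is dominated by a null
        sequence.\<close>
      have "norm (ip z x) \<le> norm z * (C * norm (y - s n))" for n
      proof -
        obtain x' where x': "x' \<in> domain A" "ip z x' = 0" "s n = app A x'"
          using s unfolding K_def by blast
        show ?thesis
          using zb[of "x - x'"] x x' dom.subspace_diff[OF subspace_domain x(1) x'(1)]
          by (simp add: dom.ip_diff_right app_diff)
      qed
      moreover have "(\<lambda>n. norm z * (C * norm (y - s n))) \<longlonglongrightarrow> 0"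
        by (intro tendsto_mult_right_zero tendsto_norm_zero)
           (use tendsto_diff[OF tendsto_const[of y] lim] in simp)
      ultimately have "norm (ip z x) \<le> 0" by (intro LIMSEQ_le_const) auto
      then show "y \<in> K" using x by (auto simp: K_def)
    qed
    note K = Ksub this
    obtain x0 where x0: "x0 \<in> domain A" "ip z x0 \<noteq> 0"
      using eq_zero_if_orthogonal_domain False by blast
    define r where "r = app A x0 - cod.proj K (app A x0)"
    have "cod.proj K (app A x0) \<in> K" by (rule cod.proj_in[OF K])
    then obtain x1 where x1: "x1 \<in> domain A" "ip z x1 = 0" "cod.proj K (app A x0) = app A x1"
      unfolding K_def by blast
    define e where "e = x0 - x1"
    have e: "e \<in> domain A" "app A e = r" "ip z e \<noteq> 0"
      using x0 x1 dom.subspace_diff[OF subspace_domain x0(1) x1(1)]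
      by (auto simp: e_def r_def app_diff dom.ip_diff_right)
    have rK: "ip' r m = 0" if "m \<in> K" for m
      unfolding r_def by (rule cod.ip_zero_commute[OF cod.proj_orthogonal[OF K that]])
    have "r \<noteq> 0" using zker[OF e(1)] e by auto
    then have rr: "ip' r r \<noteq> 0" by simp
    \<comment> \<open>The conjugate undoes the conjugate-linearity of the first argument, so that
      \<open>ip' w r = ip z e\<close>.\<close>
    define w where "w = smul' (kcnj (ip z e / ip' r r)) r"
    have wA: "ip' w (app A x) = ip z x" if x: "x \<in> domain A" for x
    proof -
      \<comment> \<open>This multiple of \<open>e\<close> makes \<open>ip z\<close> vanish on the
        difference, whose image thus lies in \<open>K\<close> and is orthogonal to
        \<open>r\<close>.\<close>
      let ?t = "ip z x / ip z e"
      have te: "smul ?t e \<in> domain A" using dom.subspace_scale[OF subspace_domain e(1)] .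
      have "app A (x - smul ?t e) \<in> K"
        unfolding K_def using x e te dom.subspace_diff[OF subspace_domain x te]
        by (intro imageI) (simp add: dom.ip_diff_right dom.ip_scale_right)
      from rK[OF this] have "ip' r (app A x) = ?t * ip' r r"
        using x e te by (simp add: app_diff app_scale cod.ip_diff_right cod.ip_scale_right)
      then show ?thesis using e(3) rr by (simp add: w_def cod.ip_scale_left kcnj_kcnj)
    qed
    \<comment> \<open>As \<open>w\<close> lies in the range, \<open>w = app A x\<close> for some
      \<open>x\<close>; its squared norm equals \<open>ip z x\<close>, to which \<open>zb\<close>
      applies.\<close>
    have "w = app A (smul (kcnj (ip z e / ip' r r)) e)" using e by (simp add: w_def app_scale)
    then have "w \<in> op_ran A" using dom.subspace_scale[OF subspace_domain e(1)] by (simp add: op_ran_def)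
    then obtain x where x: "x \<in> domain A" "app A x = w" using C by blast
    have "(norm w)\<^sup>2 = norm (ip' w w)" by (simp add: cod.ip_norm norm_power)
    also have "\<dots> \<le> norm z * (C * norm w)" using zb[OF x(1)] wA[OF x(1)] x(2) by simp
    finally have "norm w * norm w \<le> (C * norm z) * norm w"
      by (simp add: power2_eq_square mult_ac)
    then have "norm w \<le> C * norm z"
      using C0 by (cases "w = 0") simp_all
    then show ?thesis using adjoint_opI[OF wA] by blast
  qed
  with C0 show thesis by (rule that)
qed

end

section \<open>Convergence of the inner products\<close>

theorem theorem2p4:
  fixes smul0 :: "'k::real_or_complex \<Rightarrow> 'a::banach \<Rightarrow> 'a" and ip0 :: "'a \<Rightarrow> 'a \<Rightarrow> 'k"
    and smul1 :: "'k \<Rightarrow> 'b::banach \<Rightarrow> 'b" and ip1 :: "'b \<Rightarrow> 'b \<Rightarrow> 'k"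
    and smul2 :: "'k \<Rightarrow> 'c::banach \<Rightarrow> 'c" and ip2 :: "'c \<Rightarrow> 'c \<Rightarrow> 'k"
    and A0 :: "('a, 'b) partial_op" and A1 :: "('b, 'c) partial_op"
    and u v :: "nat \<Rightarrow> 'b" and u_lim v_lim :: 'b
  assumes "hilbert_space smul0 ip0" and "hilbert_space smul1 ip1" and "hilbert_space smul2 ip2"
    and "densely_defined_closed_linear smul0 smul1 A0"
    and "densely_defined_closed_linear smul1 smul2 A1"
    and "closed_sequence A0 A1"
    and "weakly_tendsto smul1 u u_lim" and "weakly_tendsto smul1 v v_lim"
    and "relatively_compactin (dual_topology smul0 (domain A0) (graph_norm A0))
           (range (\<lambda>n. weak_functional ip1 A0 (u n)))"
    and "relatively_compactin
           (dual_topology smul2 (domain (adjoint_op ip1 ip2 A1)) (graph_norm (adjoint_op ip1 ip2 A1)))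
           (range (\<lambda>n. weak_functional ip1 (adjoint_op ip1 ip2 A1) (v n)))"
    and "finite_dim_subspace smul1 (op_ker (adjoint_op ip0 ip1 A0) \<inter> op_ker A1)"
  shows "(\<lambda>n. ip1 (u n) (v n)) \<longlonglongrightarrow> ip1 u_lim v_lim"
proof -
  note D0 = densely_defined_closed_linearD[OF assms(4)]
  note D1 = densely_defined_closed_linearD[OF assms(5)]
  have seq: "op_ran A0 \<subseteq> op_ker A1" "closed (op_ran A0)" "closed (op_ran A1)"
    using assms(6) by (auto simp: closed_sequence_def)
  interpret H: hilbert_space smul1 ip1 by fact
  interpret A0: dense_hilbert_op smul0 ip0 smul1 ip1 A0
    by (intro dense_hilbert_op.intro hilbert_op.intro hilbert_op_axioms.intro
        dense_hilbert_op_axioms.intro assms D0)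
  interpret A1: dense_hilbert_op smul1 ip1 smul2 ip2 A1
    by (intro dense_hilbert_op.intro hilbert_op.intro hilbert_op_axioms.intro
        dense_hilbert_op_axioms.intro assms D1)
  interpret B: hilbert_op smul2 ip2 smul1 ip1 "adjoint_op ip1 ip2 A1"
    by (rule A1.hilbert_op_adj)
  note R = A0.subspace_ran seq(2)
  note K = A1.subspace_ker A1.closed_ker[OF D1(3)]
  let ?P = "H.proj (op_ran A0)" and ?N = "H.proj (op_ker A1)"
  note uw = H.weakly_tendsto_ip[OF assms(7)] and vw = H.weakly_tendsto_ip[OF assms(8)]

  have P: "(\<lambda>n. ?P (u n)) \<longlonglongrightarrow> ?P u_lim"
  proof -
    obtain C where "0 \<le> C" "\<And>y. y \<in> op_ran A0 \<Longrightarrow> \<exists>x\<in>domain A0. app A0 x = y \<and> norm x \<le> C * norm y"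
      using A0.bounded_lift[OF D0(3) seq(2)] by blast
    then show ?thesis
      by (rule A0.tendsto_component[OF assms(9) uw R(1)])
         (auto intro: H.proj_in[OF R] H.proj_orthogonal[OF R])
  qed

  \<comment> \<open>\<open>x - ?N x\<close> is the projection of \<open>x\<close> onto
    \<open>H.orth (op_ker A1)\<close>, because its remainder \<open>?N x\<close> lies in the
    kernel.\<close>
  have Q: "(\<lambda>n. v n - ?N (v n)) \<longlonglongrightarrow> v_lim - ?N v_lim"
  proof -
    obtain C where C: "0 \<le> C" "\<And>z. z \<in> H.orth (op_ker A1) \<Longrightarrow>
        \<exists>w\<in>domain (adjoint_op ip1 ip2 A1). app (adjoint_op ip1 ip2 A1) w = z \<and> norm w \<le> C * norm z"
      using A1.adjoint_lift[OF D1(3) seq(3)] by blast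
    have "x - ?N x \<in> H.orth (op_ker A1)" for x
      using H.proj_orthogonal[OF K] by (simp add: H.orth_def)
    moreover have "ip1 m (x - (x - ?N x)) = 0" if "m \<in> H.orth (op_ker A1)" for m x
      using that H.proj_in[OF K, of x] by (auto simp: H.orth_def intro: H.ip_zero_commute)
    ultimately show ?thesis
      by (intro B.tendsto_component[OF assms(10) vw H.subspace_orth C]) auto
  qed

  let ?F = "\<lambda>x. ?N x - ?P x"
  have Fin: "?F x \<in> op_ker (adjoint_op ip0 ip1 A0) \<inter> op_ker A1" for x
  proof
    show "?F x \<in> op_ker A1"
      using H.proj_in[OF K] H.proj_in[OF R] seq(1) by (intro H.subspace_diff[OF K(1)]) auto
    \<comment> \<open>Such an \<open>m\<close> lies in both subspaces, so \<open>?N x\<close> and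
      \<open>?P x\<close> have the same inner product with it as \<open>x\<close>.\<close>
    have "ip1 m (?F x) = 0" if "m \<in> op_ran A0" for m
      using H.ip_proj_right[OF K, of m x] H.ip_proj_right[OF R, of m x] that seq(1)
      by (auto simp: H.ip_diff_right)
    then show "?F x \<in> op_ker (adjoint_op ip0 ip1 A0)"
      using A0.orth_ran_subset_ker_adj by (auto simp: H.orth_def)
  qed
  have F: "(\<lambda>n. ?F (u n)) \<longlonglongrightarrow> ?F u_lim"
  proof -
    obtain B where "finite B" "H.span B = op_ker (adjoint_op ip0 ip1 A0) \<inter> op_ker A1"
      using assms(11) unfolding finite_dim_subspace_def by blast
    then obtain E where E: "finite E" "\<And>x. ?F x = (\<Sum>e\<in>E. smul1 (ip1 e (?F x)) e)"
      using H.orthonormal_expansion[of B] Fin by blast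
    have "(\<lambda>n. smul1 (ip1 e (?F (u n))) e) \<longlonglongrightarrow> smul1 (ip1 e (?F u_lim)) e" for e
    proof -
      \<comment> \<open>Self-adjointness moves \<open>?F\<close> onto the fixed vector
        \<open>e\<close>, so weak convergence of \<open>u\<close> gives convergence of each
        coefficient.\<close>
      have "(\<lambda>n. ip1 (?F e) (u n)) \<longlonglongrightarrow> ip1 (?F e) u_lim" by (rule uw)
      then have *: "(\<lambda>n. ip1 e (?F (u n))) \<longlonglongrightarrow> ip1 e (?F u_lim)"
        by (simp add: H.ip_diff_left H.ip_diff_right H.ip_proj_commute[OF K] H.ip_proj_commute[OF R])
      have "(\<lambda>n. norm (ip1 e (?F (u n)) - ip1 e (?F u_lim)) * norm e) \<longlonglongrightarrow> 0"
        using * by (intro tendsto_mult_left_zero tendsto_norm_zero LIM_zero)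
      then have "(\<lambda>n. norm (smul1 (ip1 e (?F (u n))) e - smul1 (ip1 e (?F u_lim)) e)) \<longlonglongrightarrow> 0"
        by (simp flip: H.scale_left_diff_distrib add: H.norm_scale)
      then show ?thesis by (simp add: tendsto_norm_zero_iff LIM_zero_iff)
    qed
    then show ?thesis by (subst E(2), subst (2) E(2)) (intro tendsto_sum)
  qed

  have split: "ip1 x y = ip1 (?P x) y + ip1 (?F x) y + ip1 x (y - ?N y)" for x y
    using H.ip_proj_commute[OF K, of x y] by (simp add: H.ip_diff_left H.ip_diff_right)
  \<comment> \<open>In the third term the strongly convergent factor comes second, so the limit is
    taken with arguments swapped and then conjugated.\<close>
  have "(\<lambda>n. ip1 (v n - ?N (v n)) (u n)) \<longlonglongrightarrow> ip1 (v_lim - ?N v_lim) u_lim"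
    by (rule H.tendsto_ip_strong_weak[OF Q uw])
  from tendsto_kcnj[OF this]
  have "(\<lambda>n. ip1 (u n) (v n - ?N (v n))) \<longlonglongrightarrow> ip1 u_lim (v_lim - ?N v_lim)"
    by (simp flip: H.ip_commute)
  then have "(\<lambda>n. ip1 (?P (u n)) (v n) + ip1 (?F (u n)) (v n) + ip1 (u n) (v n - ?N (v n)))
      \<longlonglongrightarrow> ip1 (?P u_lim) v_lim + ip1 (?F u_lim) v_lim + ip1 u_lim (v_lim - ?N v_lim)"
    by (intro tendsto_add H.tendsto_ip_strong_weak[OF P vw] H.tendsto_ip_strong_weak[OF F vw])
  then show ?thesis unfolding split[symmetric] .
qed

end
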